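(* Let $\omega = e^{\pi i/3} = \frac{1+i\sqrt3}{2}$. Let $L$ be an oriented link in $S^3$ that is the closure of a braid on $5$ strands. Then $$ADO_3(L;1)=ADO_3(L;\omega)=\begin{cases}1,&\text{if } L \text{ is a knot (i.e. has exactly one component)},\\ 0,&\text{otherwise,}\end{cases}$$ where $ADO_3(L;t)\in\mathbb{Z}[\omega,t^{\pm1}]$ is the single-colored ADO invariant of order $3$, evaluated at $t=1$ and at $t=\omega$.
   Context: **Operator invariants.** Let $V$ be a finite-dimensional vector space (over a field containing all the parameters below), $R:V\otimes V\to V\otimes V$ an invertible linear map satisfying the braid relation, and $h:V\to V$ a linear map. Let $B_n$ be the braid group on $n$ strands with Artin generators $s_1,\dots,s_{n-1}$. Define a representation $\phi_R^n$ of $B_n$ on $V^{\otimes n}$ by $$\phi_R^n(s_i)=\mathrm{id}_V^{\otimes (i-1)}\otimes R\otimes \mathrm{id}_V^{\otimes (n-i-1)}.$$ For $\beta\in B_n$ define $$O_\beta=\mathrm{trace}_{2,\dots,n}\Big(\big(\mathrm{id}_V\otimes h^{\otimes (n-1)}\big)\circ\phi^n_R(\beta)\Big):V\to V ,$$ the partial trace over tensor factors $2,\dots,n$. For the choice of $(V,R,h)$ below it is known that $O_\beta=c_\beta\,\mathrm{id}_V$ for a scalar $c_\beta$, and that $c_\beta$ depends only on the oriented link $L$ that is the closure of $\beta$ (it is unchanged by both Markov moves). The scalar $c_\beta$ is the value of the invariant on $L$. **The invariant $ADO_3(L;t)$** (all components colored by the same color $\lambda$; $t=q^\lambda$ with $q=\omega=e^{\pi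 i/3}$; normalized to be $1$ on the unknot and independent of framing). Take $V$ with basis $v_0,v_1,v_2$, $h(v_i)=t^2\omega^{2i}v_i$, and $R$ given by - $R(v_0\otimes v_0)=t^2\,v_0\otimes v_0$ - $R(v_0\otimes v_1)=(t^2-1)\,v_0\otimes v_1+t\,v_1\otimes v_0$ - $R(v_0\otimes v_2)=\frac{(t^2-1)(t^2-\omega^2)}{t^2}\,v_0\otimes v_2+(\omega t+t^{-1})\,v_1\otimes v_1+v_2\otimes v_0$ - $R(v_1\otimes v_0)=t\,v_0\otimes v_1$ - $R(v_1\otimes v_1)=(t-t^{-1})\,v_0\otimes v_2+\omega^2\,v_1\otimes v_1$ - $R(v_1\otimes v_2)=(\omega^2t^{-2}-1)\,v_1\otimes v_2-\omega t^{-1}\,v_2\otimes v_1$ - $R(v_2\otimes v_0)=v_0\otimes v_2$ - $R(v_2\otimes v_1)=-\omega t^{-1}\,v_1\otimes v_2$ - $R(v_2\otimes v_2)=\omega^2t^{-2}\,v_2\otimes v_2$ Then $ADO_3(L;t):=c_\beta\in\mathbb{Z}[\omega,t^{\pm1}]$. *)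

theory Defs
  imports "HOL-Analysis.Analysis" "HOL-Library.Poly_Mapping" "HOL-Library.Numeral_Type"
begin

text \<open>
  An element of the braid group on \<open>n\<close> strands is given by a word in the Artin generators
  \<open>s\<^sub>1, \<dots>, s\<^sub>n\<^sub>-\<^sub>1\<close> and their inverses.
\<close>

datatype artin = Gen nat | GenInv nat

fun artin_index :: "artin \<Rightarrow> nat" where
  "artin_index (Gen i) = i"
| "artin_index (GenInv i) = i"

definition braid_word :: "nat \<Rightarrow> artin list \<Rightarrow> bool" where
  "braid_word n \<beta> \<longleftrightarrow> (\<forall>a\<in>set \<beta>. 1 \<le> artin_index a \<and> artin_index a < n)"

text \<open>
  \<open>crossing_strand a j \<tau>\<close> is the pair (position, height) at time \<open>\<tau> \<in> [0,1]\<close> of the strand that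
  starts at position \<open>j\<close> in the elementary braid \<open>a\<close>. In \<open>s\<^sub>i\<close> the strand going from \<open>i\<close> to
  \<open>i + 1\<close> is the upper one; in the inverse it is the strand going from \<open>i + 1\<close> to \<open>i\<close>.
\<close>

fun crossing_strand :: "artin \<Rightarrow> nat \<Rightarrow> real \<Rightarrow> real \<times> real" where
  "crossing_strand (Gen i) j \<tau> =
     (if j = i then (real i + \<tau>, \<tau> * (1 - \<tau>))
      else if j = i + 1 then (real (i + 1) - \<tau>, 0)
      else (real j, 0))"
| "crossing_strand (GenInv i) j \<tau> =
     (if j = i then (real i + \<tau>, 0)
      else if j = i + 1 then (real (i + 1) - \<tau>, \<tau> * (1 - \<tau>))
      else (real j, 0))"

text \<open>
  The closure of a braid is formed around the axis \<open>{0} \<times> \<real>\<close> of \<open>\<complex> \<times> \<real> = \<real>\<^sup>3 \<subset> S\<^sup>3\<close>: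
  the full turn is divided into \<open>length \<beta> + 1\<close> equal sectors, one for each letter and a last one
  in which all strands are parallel. The position of a strand is its distance from the axis.
  Strands are oriented by increasing angle. A product of braids acts on tensor powers as a
  composition of operators, so its right factor comes first along the strands; hence \<open>rev\<close>.
\<close>

definition sector_strand :: "artin list \<Rightarrow> nat \<Rightarrow> nat \<Rightarrow> real \<Rightarrow> real \<times> real" where
  "sector_strand \<beta> k j \<tau> =
     (if k < length \<beta> then crossing_strand (rev \<beta> ! k) j \<tau> else (real j, 0))"

definition closure_arc :: "artin list \<Rightarrow> nat \<Rightarrow> nat \<Rightarrow> real \<Rightarrow> complex \<times> real" where
  "closure_arc \<beta> k j \<tau> =
     (let (r, z) = sector_strand \<beta> k j \<tau>
      in (of_real r * cis (2 * pi * (real k + \<tau>) / real (length \<beta> + 1)), z))"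

definition braid_closure :: "nat \<Rightarrow> artin list \<Rightarrow> (complex \<times> real) set" where
  "braid_closure n \<beta> = (\<Union>k\<in>{0..length \<beta>}. \<Union>j\<in>{1..n}. closure_arc \<beta> k j ` {0..1})"

definition is_knot :: "(complex \<times> real) set \<Rightarrow> bool" where
  "is_knot L \<longleftrightarrow> card (components L) = 1"

text \<open>
  \<open>V\<close> is the free module with basis indexed by the finite type \<open>'d\<close>. A vector of the \<open>n\<close>-th
  tensor power is given by its coordinates with respect to the basis of pure tensors, which is
  indexed by the lists of length \<open>n\<close> over \<open>'d\<close>. Values at lists of other lengths are
  irrelevant: all operators below preserve the length.
\<close>

type_synonym ('a, 'd) tensor = "'d list \<Rightarrow> 'a"

definition pure_tensor :: "'d list \<Rightarrow> ('a::zero_neq_one, 'd) tensor" where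
  "pure_tensor x = (\<lambda>y. if y = x then 1 else 0)"

text \<open>
  A linear map \<open>M\<close> of the tensor square of \<open>V\<close> (as a matrix) acting on the factors
  \<open>i\<close> and \<open>i + 1\<close>; factors are counted from 1, list entries from 0.
\<close>

definition act_at ::
    "nat \<Rightarrow> 'a^('d \<times> 'd)^('d \<times> 'd) \<Rightarrow> ('a::comm_ring_1, 'd::finite) tensor \<Rightarrow> ('a, 'd) tensor" where
  "act_at i M f = (\<lambda>x. \<Sum>(c, d)\<in>UNIV. M $ (x ! (i - 1), x ! i) $ (c, d) * f (x[i - 1 := c, i := d]))"

fun braid_letter_op ::
    "'a^('d \<times> 'd)^('d \<times> 'd) \<Rightarrow> artin \<Rightarrow> ('a::comm_ring_1, 'd::finite) tensor \<Rightarrow> ('a, 'd) tensor" where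
  "braid_letter_op R (Gen i) = act_at i R"
| "braid_letter_op R (GenInv i) = act_at i (matrix_inv R)"

fun braid_op ::
    "'a^('d \<times> 'd)^('d \<times> 'd) \<Rightarrow> artin list \<Rightarrow> ('a::comm_ring_1, 'd::finite) tensor \<Rightarrow> ('a, 'd) tensor" where
  "braid_op R [] = id"
| "braid_op R (a # \<beta>) = braid_letter_op R a \<circ> braid_op R \<beta>"

definition id_tensor_h ::
    "nat \<Rightarrow> 'a^'d^'d \<Rightarrow> ('a::comm_ring_1, 'd::finite) tensor \<Rightarrow> ('a, 'd) tensor" where
  "id_tensor_h n h f =
     (\<lambda>x. \<Sum>y | length y = n \<and> y ! 0 = x ! 0. (\<Prod>k\<in>{1..<n}. h $ (x ! k) $ (y ! k)) * f y)"

definition partial_trace ::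
    "nat \<Rightarrow> (('a::comm_ring_1, 'd::finite) tensor \<Rightarrow> ('a, 'd) tensor) \<Rightarrow> 'a^'d^'d" where
  "partial_trace n T = (\<chi> i j. \<Sum>a | length a = n - 1. T (pure_tensor (j # a)) (i # a))"

definition operator_invariant ::
    "'a^('d \<times> 'd)^('d \<times> 'd) \<Rightarrow> 'a^'d^'d \<Rightarrow> nat \<Rightarrow> artin list \<Rightarrow> ('a::comm_ring_1)^('d::finite)^'d" where
  "operator_invariant R h n \<beta> = partial_trace n (id_tensor_h n h \<circ> braid_op R \<beta>)"

text \<open>
  Laurent polynomials with complex coefficients, as the monoid algebra of the additive group of
  integers.
\<close>

type_synonym laurent = "int \<Rightarrow>\<^sub>0 complex"

definition laurent_const :: "complex \<Rightarrow> laurent" where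
  "laurent_const c = Poly_Mapping.single 0 c"

definition laurent_eval :: "laurent \<Rightarrow> complex \<Rightarrow> complex" where
  "laurent_eval p z = (\<Sum>k\<in>Poly_Mapping.keys p. Poly_Mapping.lookup p k * z powi k)"

definition omega :: complex where
  "omega = exp (\<i> * of_real pi / 3)"

text \<open>
  The basis of \<open>V\<close> is indexed by \<open>0, 1, 2\<close> of the numeral type \<open>3\<close>. In the next two
  definitions \<open>u\<close> stands for the inverse of \<open>t\<close>, and \<open>w\<close> for the root of unity.
  \<open>ado_R_image w t u a b\<close> is the image under \<open>R\<close> of the tensor product of the basis
  vectors with indices \<open>a\<close> and \<open>b\<close>.
\<close>

definition ado_R_image :: "'a::comm_ring_1 \<Rightarrow> 'a \<Rightarrow> 'a \<Rightarrow> 3 \<Rightarrow> 3 \<Rightarrow> 'a^(3 \<times> 3)" where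
  "ado_R_image w t u a b =
     (let v = (\<lambda>c d. axis (c, d) 1) in
      if (a, b) = (0, 0) then t^2 *s v 0 0
      else if (a, b) = (0, 1) then (t^2 - 1) *s v 0 1 + t *s v 1 0
      else if (a, b) = (0, 2) then
        ((t^2 - 1) * (t^2 - w^2) * u^2) *s v 0 2 + (w * t + u) *s v 1 1 + v 2 0
      else if (a, b) = (1, 0) then t *s v 0 1
      else if (a, b) = (1, 1) then (t - u) *s v 0 2 + w^2 *s v 1 1
      else if (a, b) = (1, 2) then (w^2 * u^2 - 1) *s v 1 2 - (w * u) *s v 2 1
      else if (a, b) = (2, 0) then v 0 2
      else if (a, b) = (2, 1) then - ((w * u) *s v 1 2)
      else (w^2 * u^2) *s v 2 2)"

definition ado_R :: "'a::comm_ring_1 \<Rightarrow> 'a \<Rightarrow> 'a \<Rightarrow> 'a^(3 \<times> 3)^(3 \<times> 3)" where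
  "ado_R w t u = (\<chi> p q. ado_R_image w t u (fst q) (snd q) $ p)"

definition ado_h :: "'a::comm_ring_1 \<Rightarrow> 'a \<Rightarrow> 'a^3^3" where
  "ado_h w t =
     (\<chi> i j. if i \<noteq> j then 0 else if i = 0 then t^2 else if i = 1 then t^2 * w^2 else t^2 * w^4)"

definition ado_operator :: "nat \<Rightarrow> artin list \<Rightarrow> laurent^3^3" where
  "ado_operator n \<beta> =
     (let w = laurent_const omega; t = Poly_Mapping.single 1 1; u = Poly_Mapping.single (-1) 1
      in operator_invariant (ado_R w t u) (ado_h w t) n \<beta>)"

text \<open>
  The value of the invariant on the closure of the braid \<open>\<beta>\<close> on \<open>n\<close> strands: the scalar by
  which the operator acts (\<open>mat c\<close> is the scalar matrix \<open>c\<close>).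
\<close>

definition ADO3 :: "nat \<Rightarrow> artin list \<Rightarrow> laurent" where
  "ADO3 n \<beta> = (THE c. ado_operator n \<beta> = mat c)"

end

theory Submission
  imports Defs "HOL-Combinatorics.Cycles"
begin

text \<open>
  The matrix \<open>R\<close> commutes with the coproduct of a lowering operator of quantum sl(2), for which
  \<open>h\<close> is a multiple of the group-like element. Hence the partial trace is a scalar, which can
  be read off at any basis vector, and its specialisations are those of the entries of \<open>R\<close>.

  For \<open>t = 1\<close> and \<open>t = \<omega>\<close> the matrix \<open>R\<close> is triangular with respect to the number of tensor
  factors equal to \<open>v\<^sub>0\<close> (respectively \<open>v\<^sub>2\<close>), so only its graded part contributes to the
  trace. There this vector is transparent, and on the span of the other two, of quantum
  dimension \<open>-1\<close>, \<open>R + 1\<close> is a multiple of the projection to a module of quantum dimension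
  \<open>0\<close>. So the trace does not change when \<open>R\<close> and its inverse are replaced by \<open>-1\<close> on that
  span. What remains is a sum over the colourings of the components with two colours, the
  component of the first strand being transparent, in which each nontransparent component
  contributes a factor \<open>-1\<close>. The sum is \<open>(1 - 1)\<^sup>c\<close> where \<open>c\<close> is the number of the other
  components.
\<close>

section \<open>Linear operators on tensor powers\<close>

text \<open>Cyclicity holds for full traces, while the invariant is a partial one. The first factor
  is therefore cut down by a matrix unit or a projection inside a trace over all factors. Since
  \<open>h\<close> is a scalar multiple of the group-like \<open>k\<close>, a commutator with the
  coproduct on two factors, tensored with \<open>h\<close> on the others, is a commutator with the
  iterated coproduct on the whole tensor power. This gives independence of the basis vector. Quantum
  dimension 0 is used in the same way: for the weights w^2 and w^4 the trace of k \<otimes> k on the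
  three-dimensional summand is w^4 + w^6 + w^8 = 0, and the operator in question is an explicit
  commutator. The summand may occur at any two neighbouring factors; a braid relation and
  conjugation move it to the first two. The first factor, which is not closed up, causes no trouble
  because the transparent vector spans a trivial module, so projecting onto it is an intertwiner.
  Components are not counted. A nonconstant colouring of the strands that closes up disconnects the
  closure, and recolouring one orbit gives a sign-reversing involution on the sum.\<close>

definition linear_on :: "nat \<Rightarrow> (('a::comm_ring_1, 'd) tensor \<Rightarrow> ('a, 'd) tensor) \<Rightarrow> bool" where
  "linear_on n A \<longleftrightarrow>
     (\<forall>f x. length x = n \<longrightarrow> A f x = (\<Sum>y | length y = n. A (pure_tensor y) x * f y))"

definition op_trace :: "nat \<Rightarrow> (('a::comm_ring_1, 'd) tensor \<Rightarrow> ('a, 'd) tensor) \<Rightarrow> 'a" where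
  "op_trace n A = (\<Sum>x | length x = n. A (pure_tensor x) x)"

definition scale :: "('d list \<Rightarrow> 'a) \<Rightarrow> ('a::comm_ring_1, 'd) tensor \<Rightarrow> ('a, 'd) tensor" where
  "scale w f = (\<lambda>x. w x * f x)"

definition commute_on ::
    "nat \<Rightarrow> (('a::comm_ring_1, 'd) tensor \<Rightarrow> ('a, 'd) tensor) \<Rightarrow> (('a, 'd) tensor \<Rightarrow> ('a, 'd) tensor) \<Rightarrow> bool"
  where "commute_on n A B \<longleftrightarrow> (\<forall>f x. length x = n \<longrightarrow> A (B f) x = B (A f) x)"

lemma finite_lists_of_length [simp]: "finite {x :: 'd::finite list. length x = n}"
  using finite_lists_length_eq[of "UNIV :: 'd set" n] by simp

lemma sum_pure_tensor:
  fixes k :: "'d::finite list \<Rightarrow> 'a::comm_ring_1"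
  assumes "length z = n"
  shows "(\<Sum>y | length y = n. k y * pure_tensor z y) = k z"
proof -
  have "(\<Sum>y | length y = n. k y * pure_tensor z y) = (\<Sum>y | length y = n. if z = y then k y else 0)"
    by (rule sum.cong) (auto simp: pure_tensor_def)
  also have "\<dots> = k z" using assms by (subst sum.delta') auto
  finally show ?thesis .
qed

lemma pure_tensor_commute: "pure_tensor x y = pure_tensor y x"
  by (auto simp: pure_tensor_def)

text \<open>The kernel \<open>k\<close> is forced, since pure tensors recover its entries. So
  \<open>linear_on\<close> expresses linearity and, at the same time, that values at lists of other
  lengths have no influence on lists of length \<open>n\<close>.\<close>

lemma linear_onI:
  fixes A :: "('a::comm_ring_1, 'd::finite) tensor \<Rightarrow> ('a, 'd) tensor"
  assumes "\<And>f x. length x = n \<Longrightarrow> A f x = (\<Sum>y | length y = n. k x y * f y)"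
  shows "linear_on n A"
  by (auto simp: linear_on_def assms sum_pure_tensor)

lemma linear_onD:
  "linear_on n A \<Longrightarrow> length x = n \<Longrightarrow> A f x = (\<Sum>y | length y = n. A (pure_tensor y) x * f y)"
  unfolding linear_on_def by blast

lemma linear_on_cong:
  assumes "linear_on n A" "length x = n" "\<And>y. length y = n \<Longrightarrow> f y = g y"
  shows "A f x = A g x"
  unfolding linear_onD[OF assms(1,2), of f] linear_onD[OF assms(1,2), of g]
  using assms(3) by (intro sum.cong) auto

lemma linear_on_id: "linear_on n (id :: ('a::comm_ring_1, 'd::finite) tensor \<Rightarrow> _)"
proof (rule linear_onI)
  fix f :: "('a, 'd) tensor" and x :: "'d list" assume "length x = n"
  then show "id f x = (\<Sum>y | length y = n. pure_tensor x y * f y)"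
    using sum_pure_tensor[of x n f] by (simp add: mult.commute)
qed

lemma linear_on_comp:
  fixes A :: "('a::comm_ring_1, 'd::finite) tensor \<Rightarrow> ('a, 'd) tensor"
  assumes A: "linear_on n A" and B: "linear_on n B"
  shows "linear_on n (A \<circ> B)"
proof (rule linear_onI)
  fix f and x :: "'d list" assume x: "length x = n"
  have "(A \<circ> B) f x = (\<Sum>y | length y = n. A (pure_tensor y) x * B f y)"
    using linear_onD[OF A x, of "B f"] by simp
  also have "\<dots> = (\<Sum>y | length y = n. \<Sum>z | length z = n. A (pure_tensor y) x * B (pure_tensor z) y * f z)"
    by (rule sum.cong) (auto simp: linear_onD[OF B, of _ f] sum_distrib_left mult.assoc)
  also have "\<dots> = (\<Sum>z | length z = n. (\<Sum>y | length y = n. A (pure_tensor y) x * B (pure_tensor z) y) * f z)"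
    by (subst sum.swap) (simp add: sum_distrib_right)
  finally show "(A \<circ> B) f x = \<dots>" .
qed

lemma linear_on_scale: "linear_on n (scale w :: ('a::comm_ring_1, 'd::finite) tensor \<Rightarrow> _)"
proof (rule linear_onI)
  fix f :: "('a, 'd) tensor" and x :: "'d list" assume "length x = n"
  then show "scale w f x = (\<Sum>y | length y = n. (w x * pure_tensor x y) * f y)"
    using sum_pure_tensor[of x n "\<lambda>y. w x * f y"] by (simp add: scale_def mult_ac)
qed

lemma op_trace_cong:
  assumes "\<And>f x. length x = n \<Longrightarrow> A f x = B f x"
  shows "op_trace n A = op_trace n B"
  unfolding op_trace_def by (rule sum.cong) (auto simp: assms)

lemma op_trace_commute:
  fixes A :: "('a::comm_ring_1, 'd::finite) tensor \<Rightarrow> ('a, 'd) tensor"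
  assumes A: "linear_on n A" and B: "linear_on n B"
  shows "op_trace n (A \<circ> B) = op_trace n (B \<circ> A)"
proof -
  have *: "op_trace n (A \<circ> B) = (\<Sum>x | length x = n. \<Sum>y | length y = n. A (pure_tensor y) x * B (pure_tensor x) y)"
    if "linear_on n A" for A B :: "('a, 'd) tensor \<Rightarrow> ('a, 'd) tensor"
    unfolding op_trace_def by (rule sum.cong) (auto simp: linear_onD[OF that, of _ "B _"])
  show ?thesis
    unfolding *[OF A] *[OF B] by (subst sum.swap) (simp add: mult.commute)
qed

lemma commute_on_comp:
  fixes A :: "('a::comm_ring_1, 'd::finite) tensor \<Rightarrow> ('a, 'd) tensor"
  assumes "linear_on n A" "commute_on n A C" "commute_on n B C"
  shows "commute_on n (A \<circ> B) C"
  unfolding commute_on_def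
proof (intro allI impI)
  fix f and x :: "'d list" assume x: "length x = n"
  have "A (B (C f)) x = A (C (B f)) x"
    using assms(3) by (intro linear_on_cong[OF assms(1) x]) (auto simp: commute_on_def)
  then show "(A \<circ> B) (C f) x = C ((A \<circ> B) f) x"
    using assms(2) x by (simp add: commute_on_def)
qed

lemma commute_on_id: "commute_on n id C"
  by (simp add: commute_on_def)

lemma act_at_eq:
  "act_at i M f x = (\<Sum>q\<in>UNIV. M $ (x ! (i - 1), x ! i) $ q * f (x[i - 1 := fst q, i := snd q]))"
  by (simp add: act_at_def case_prod_unfold)

lemma act_at_first:
  "act_at (Suc 0) M f (a # b # y) = (\<Sum>q\<in>UNIV. M $ (a, b) $ q * f (fst q # snd q # y))"
  by (simp add: act_at_eq)

lemma act_at_Suc: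
  "1 \<le> i \<Longrightarrow> act_at (Suc i) M f (a # x) = act_at i M (\<lambda>y. f (a # y)) x"
  by (cases i) (auto simp: act_at_eq)

lemma linear_on_act_at:
  assumes "1 \<le> i" "i < n"
  shows "linear_on n (act_at i M :: ('a::comm_ring_1, 'd::finite) tensor \<Rightarrow> _)"
proof (rule linear_onI)
  fix f :: "('a, 'd) tensor" and x :: "'d list" assume x: "length x = n"
  have "act_at i M f x = (\<Sum>q\<in>UNIV. \<Sum>y | length y = n.
      M $ (x ! (i - 1), x ! i) $ q * f y * pure_tensor (x[i - 1 := fst q, i := snd q]) y)"
    unfolding act_at_eq by (rule sum.cong) (use x in \<open>auto simp: sum_pure_tensor\<close>)
  also have "\<dots> = (\<Sum>y | length y = n. (\<Sum>q\<in>UNIV.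
      M $ (x ! (i - 1), x ! i) $ q * pure_tensor (x[i - 1 := fst q, i := snd q]) y) * f y)"
    by (subst sum.swap) (simp add: sum_distrib_left sum_distrib_right mult_ac)
  finally show "act_at i M f x = \<dots>" .
qed

lemma act_at_mult:
  assumes "1 \<le> i" "i < length x"
  shows "act_at i M (act_at i N f) x = act_at i (M ** N) f x"
proof -
  have "act_at i M (act_at i N f) x = (\<Sum>q\<in>UNIV. \<Sum>r\<in>UNIV.
      M $ (x ! (i - 1), x ! i) $ q * N $ q $ r * f (x[i - 1 := fst r, i := snd r]))"
    using assms
    by (auto simp: act_at_eq[of _ M] act_at_eq[of _ N] sum_distrib_left mult.assoc list_update_swap
        nth_list_update intro!: sum.cong)
  also have "\<dots> = act_at i (M ** N) f x"
    by (subst sum.swap) (simp add: act_at_eq matrix_matrix_mult_def sum_distrib_right)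
  finally show ?thesis .
qed

lemma act_at_diff: "act_at i (M - N) f x = act_at i M f x - act_at i N f x"
  by (simp add: act_at_eq left_diff_distrib sum_subtractf)

lemma list_pair_split:
  assumes "1 \<le> i" "i < length x"
  shows "x = take (i - 1) x @ x ! (i - 1) # x ! i # drop (Suc i) x"
  using assms by (cases i) (simp_all add: Cons_nth_drop_Suc)

lemma list_pair_update:
  assumes "1 \<le> i" "i < length x"
  shows "x[i - 1 := c, i := d] = take (i - 1) x @ c # d # drop (Suc i) x"
  using assms by (subst list_pair_split[OF assms]) (cases i; simp add: list_update_append)

lemma prod_list_pair:
  fixes k :: "'d \<Rightarrow> 'a::comm_monoid_mult"
  assumes "1 \<le> i" "i < length x"
  shows "prod_list (map k x) =
    prod_list (map k (take (i - 1) x)) * (k (x ! (i - 1)) * k (x ! i)) * prod_list (map k (drop (Suc i) x))"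
  by (subst list_pair_split[OF assms]) (simp add: mult_ac)

lemma prod_list_pair_update:
  fixes k :: "'d \<Rightarrow> 'a::comm_monoid_mult"
  assumes "1 \<le> i" "i < length x"
  shows "prod_list (map k (x[i - 1 := c, i := d])) =
    prod_list (map k (take (i - 1) x)) * (k c * k d) * prod_list (map k (drop (Suc i) x))"
  by (simp only: list_pair_update[OF assms]) (simp add: mult_ac)

section \<open>Words of local operators and the iterated coproduct\<close>

fun word_op ::
    "(nat \<times> ('a^('d \<times> 'd)^('d \<times> 'd))) list \<Rightarrow> ('a::comm_ring_1, 'd::finite) tensor \<Rightarrow> ('a, 'd) tensor" where
  "word_op [] = id"
| "word_op ((i, M) # w) = act_at i M \<circ> word_op w"

lemma linear_on_word_op:
  "\<forall>(i, M)\<in>set w. 1 \<le> i \<and> i < n \<Longrightarrow> linear_on n (word_op w)"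
  by (induction w rule: word_op.induct)
    (auto intro!: linear_on_id linear_on_comp linear_on_act_at simp del: comp_apply)

lemma commute_on_word_op:
  "\<forall>(i, M)\<in>set w. 1 \<le> i \<and> i < n \<and> commute_on n (act_at i M) C \<Longrightarrow> commute_on n (word_op w) C"
  by (induction w rule: word_op.induct)
    (auto intro!: commute_on_id commute_on_comp linear_on_act_at simp del: comp_apply)

text \<open>
  The action of a generator \<open>e\<close> with coproduct \<open>e \<otimes> k + 1 \<otimes> e\<close> on all tensor powers, where
  \<open>k\<close> is group-like and diagonal.
\<close>

fun ladder ::
    "'a^'d^'d \<Rightarrow> ('d \<Rightarrow> 'a) \<Rightarrow> ('a::comm_ring_1, 'd::finite) tensor \<Rightarrow> ('a, 'd) tensor" where
  "ladder e k f [] = 0"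
| "ladder e k f (a # x) =
     prod_list (map k x) * (\<Sum>c\<in>UNIV. e $ a $ c * f (c # x)) + ladder e k (\<lambda>y. f (a # y)) x"

definition coproduct :: "'a^'d^'d \<Rightarrow> ('d \<Rightarrow> 'a) \<Rightarrow> ('a::comm_ring_1)^('d::finite \<times> 'd)^('d \<times> 'd)" where
  "coproduct e k = (\<chi> p q. (if snd p = snd q then e $ fst p $ fst q * k (snd p) else 0)
     + (if fst p = fst q then e $ snd p $ snd q else 0))"

lemma coproduct_nth:
  "coproduct e k $ (a, b) $ (c, d) =
     (if b = d then e $ a $ c * k b else 0) + (if a = c then e $ b $ d else 0)"
  by (simp add: coproduct_def)

lemma sum_prod_UNIV: "(\<Sum>q\<in>UNIV. f q) = (\<Sum>a\<in>UNIV. \<Sum>b\<in>UNIV. f (a, b))"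
  by (simp add: sum.cartesian_product flip: UNIV_Times_UNIV)

text \<open>Coassociativity: the summands of the iterated coproduct with \<open>e\<close> in one of
  the first two factors combine to the coproduct on these two, with \<open>k\<close> on all the
  others.\<close>

lemma ladder_two:
  "ladder e k f (a # b # y) =
     prod_list (map k y) * act_at 1 (coproduct e k) f (a # b # y) + ladder e k (\<lambda>z. f (a # b # z)) y"
proof -
  have "(\<Sum>c\<in>UNIV. \<Sum>d\<in>UNIV. (if b = d then e $ a $ c * k b else 0) * f (c # d # y))
      = k b * (\<Sum>c\<in>UNIV. e $ a $ c * f (c # b # y))"
    by (simp add: if_distrib[of "\<lambda>z. z * _"] sum_distrib_left cong: if_cong) (simp add: mult_ac)
  moreover have "(\<Sum>c\<in>UNIV. \<Sum>d\<in>UNIV. (if a = c then e $ b $ d else 0) * f (c # d # y))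
      = (\<Sum>d\<in>UNIV. e $ b $ d * f (a # d # y))"
    by (subst sum.swap) (simp add: if_distrib[of "\<lambda>z. z * _"] cong: if_cong)
  ultimately show ?thesis
    by (simp add: act_at_first coproduct_nth sum_prod_UNIV distrib_right sum.distrib distrib_left mult_ac)
qed

lemma ladder_cong:
  "(\<And>z. length z = length x \<Longrightarrow> f z = f' z) \<Longrightarrow> ladder e k f x = ladder e k f' x"
proof (induction x arbitrary: f f')
  case (Cons a x)
  have "ladder e k (\<lambda>y. f (a # y)) x = ladder e k (\<lambda>y. f' (a # y)) x"
    by (rule Cons.IH) (use Cons.prems in simp)
  then show ?case using Cons.prems by simp
qed simp

lemma ladder_sum:
  "ladder e k (\<lambda>x. \<Sum>q\<in>S. c q * f q x) x = (\<Sum>q\<in>S. c q * ladder e k (f q) x)"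
proof (induction x arbitrary: f)
  case (Cons a x)
  have "(\<Sum>c'\<in>UNIV. e $ a $ c' * (\<Sum>q\<in>S. c q * f q (c' # x)))
      = (\<Sum>q\<in>S. c q * (\<Sum>c'\<in>UNIV. e $ a $ c' * f q (c' # x)))"
    by (simp add: sum_distrib_left mult_ac) (rule sum.swap)
  then show ?case
    using Cons[of "\<lambda>q y. f q (a # y)"]
    by (simp add: sum_distrib_left distrib_left sum.distrib mult_ac)
qed simp

text \<open>The assumption says that the diagonal matrix \<open>g\<close> commutes with
  \<open>e\<close>; hence its tensor powers commute with the iterated coproduct.\<close>

lemma ladder_scale:
  assumes "\<And>a c. e $ a $ c \<noteq> 0 \<Longrightarrow> g a = g c"
  shows "ladder e k (\<lambda>x. prod_list (map g x) * f x) x = prod_list (map g x) * ladder e k f x"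
proof -
  have *: "e $ a $ c * (g c * z) = g a * (e $ a $ c * z)" for a c z
    using assms[of a c] by (cases "e $ a $ c = 0") (auto simp: mult_ac)
  show ?thesis
  proof (induction x arbitrary: f)
    case (Cons a x)
    have "ladder e k (\<lambda>y. g a * prod_list (map g y) * f (a # y)) x
        = g a * (prod_list (map g x) * ladder e k (\<lambda>y. f (a # y)) x)"
      using Cons[of "\<lambda>y. g a * f (a # y)"] ladder_sum[of e k "\<lambda>_. g a" "\<lambda>_ y. f (a # y)" "{()}" x]
      by (simp add: mult_ac)
    moreover have "(\<Sum>c\<in>UNIV. e $ a $ c * (g c * prod_list (map g x) * f (c # x)))
        = g a * prod_list (map g x) * (\<Sum>c\<in>UNIV. e $ a $ c * f (c # x))"
      by (simp add: sum_distrib_left * mult.assoc) (simp add: mult_ac)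
    ultimately show ?case by (simp add: distrib_left mult_ac)
  qed simp
qed

lemma linear_on_ladder:
  "linear_on n (ladder e k :: ('a::comm_ring_1, 'd::finite) tensor \<Rightarrow> ('a, 'd) tensor)"
  unfolding linear_on_def
proof (intro allI impI)
  fix f :: "('a, 'd) tensor" and x :: "'d list" assume x: "length x = n"
  have "(\<Sum>y | length y = n. f y * pure_tensor y z) = f z" if "length z = length x" for z
    using sum_pure_tensor[of z n f] that x
    by (simp only: pure_tensor_commute[of z])
  then have "ladder e k f x = ladder e k (\<lambda>z. \<Sum>y | length y = n. f y * pure_tensor y z) x"
    by (intro ladder_cong) simp
  also have "\<dots> = (\<Sum>y | length y = n. ladder e k (pure_tensor y) x * f y)"
    by (subst ladder_sum) (simp add: mult.commute)
  finally show "ladder e k f x = \<dots>" .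
qed

text \<open>An \<open>e\<close> to the left of the two factors meets \<open>M\<close> only through k
  \<otimes> k, an \<open>e\<close> on one of them is part of the coproduct, and an \<open>e\<close>
  to the right does not meet \<open>M\<close> at all. The two assumptions on \<open>M\<close> deal
  with the first two cases.\<close>

lemma act_at_ladder:
  assumes M: "M ** coproduct e k = coproduct e k ** M"
    and kk: "\<And>p q. M $ p $ q \<noteq> 0 \<Longrightarrow> k (fst p) * k (snd p) = k (fst q) * k (snd q)"
    and i: "1 \<le> i" "i < length x"
  shows "act_at i M (ladder e k f) x = ladder e k (act_at i M f) x"
  using i
proof (induction i arbitrary: x f)
  case (Suc i)
  obtain a b y where x: "x = a # b # y"
    using Suc.prems by (cases x; cases "tl x") auto
  show ?case
  proof (cases "i = 0")
    case True
    have "act_at 1 M (ladder e k f) x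
        = (\<Sum>q\<in>UNIV. M $ (a, b) $ q * (prod_list (map k y) * act_at 1 (coproduct e k) f (fst q # snd q # y)))
        + (\<Sum>q\<in>UNIV. M $ (a, b) $ q * ladder e k (\<lambda>z. f (fst q # snd q # z)) y)"
      by (simp only: x act_at_first[of M] One_nat_def ladder_two distrib_left sum.distrib)
    also have "\<dots> = prod_list (map k y) * act_at 1 M (act_at 1 (coproduct e k) f) x
        + ladder e k (\<lambda>z. act_at 1 M f (a # b # z)) y"
      by (simp add: x act_at_first[of M] ladder_sum sum_distrib_left mult_ac)
    also have "act_at 1 M (act_at 1 (coproduct e k) f) x = act_at 1 (coproduct e k) (act_at 1 M f) x"
      by (simp add: x act_at_mult M)
    finally show ?thesis
      using True by (simp add: x ladder_two del: ladder.simps)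
  next
    case False
    then have i: "1 \<le> i" "i < length (b # y)" using Suc.prems x by auto
    have kprod: "M $ ((b # y) ! (i - 1), (b # y) ! i) $ q * prod_list (map k ((b # y)[i - 1 := fst q, i := snd q]))
        = M $ ((b # y) ! (i - 1), (b # y) ! i) $ q * prod_list (map k (b # y))" for q
    proof (cases "M $ ((b # y) ! (i - 1), (b # y) ! i) $ q = 0")
      case False
      show ?thesis
        using kk[OF False] by (simp only: prod_list_pair[OF i] prod_list_pair_update[OF i] fst_conv snd_conv)
    qed simp
    have "act_at (Suc i) M (ladder e k f) (a # b # y) = act_at i M (\<lambda>z. ladder e k f (a # z)) (b # y)"
      using i by (simp add: act_at_Suc)
    also have "\<dots> = (\<Sum>q\<in>UNIV. M $ ((b # y) ! (i - 1), (b # y) ! i) $ q * (prod_list (map k (b # y))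
           * (\<Sum>c\<in>UNIV. e $ a $ c * f (c # (b # y)[i - 1 := fst q, i := snd q]))))
        + act_at i M (ladder e k (\<lambda>z. f (a # z))) (b # y)"
      unfolding act_at_eq
      by (simp only: ladder.simps distrib_left sum.distrib mult.assoc[symmetric] kprod)
    also have "(\<Sum>q\<in>UNIV. M $ ((b # y) ! (i - 1), (b # y) ! i) $ q * (prod_list (map k (b # y))
           * (\<Sum>c\<in>UNIV. e $ a $ c * f (c # (b # y)[i - 1 := fst q, i := snd q]))))
        = prod_list (map k (b # y)) * (\<Sum>c\<in>UNIV. e $ a $ c * act_at (Suc i) M f (c # b # y))"
      by (subst act_at_Suc[OF i(1)])
        (simp only: act_at_eq sum_distrib_left mult_ac sum.swap[of _ "UNIV :: 'b set"])
    also have "act_at i M (ladder e k (\<lambda>z. f (a # z))) (b # y)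
        = ladder e k (\<lambda>z. act_at (Suc i) M f (a # z)) (b # y)"
      using Suc.IH[OF i] by (simp only: act_at_Suc[OF i(1)])
    finally show ?thesis by (simp add: x)
  qed
qed simp

text \<open>
  Since \<open>g = h k\<^sup>-\<^sup>1\<close> commutes with \<open>e\<close>, the commutator on the first two factors extends to a
  commutator on all of them.
\<close>

lemma op_trace_commutator:
  fixes T :: "('a::comm_ring_1, 'd::finite) tensor \<Rightarrow> ('a, 'd) tensor"
  assumes n: "2 \<le> n" and T: "linear_on n T" "commute_on n T (ladder e k)"
    and h: "\<And>a. h a = k a * g a" and g: "\<And>a c. e $ a $ c \<noteq> 0 \<Longrightarrow> g a = g c"
  shows "op_trace n (act_at 1 (coproduct e k ** Y - Y ** coproduct e k)
    \<circ> scale (\<lambda>x. prod_list (map h (drop 2 x))) \<circ> T) = 0"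
proof -
  let ?E = "ladder e k" and ?C = "coproduct e k"
  define Z :: "('a, 'd) tensor \<Rightarrow> ('a, 'd) tensor"
    where "Z = act_at 1 Y \<circ> scale (\<lambda>x. prod_list (map g (drop 2 x)))"
  have Z: "linear_on n Z" and E: "linear_on n ?E"
    unfolding Z_def using n by (auto intro!: linear_on_comp linear_on_act_at linear_on_scale linear_on_ladder)
  have hkg: "prod_list (map h y) = prod_list (map k y) * prod_list (map g y)" for y
    by (induction y) (auto simp: h mult_ac)
  \<comment> \<open>On the factors from the third on, the iterated coproduct commutes with the
    powers of \<open>g\<close> and these summands cancel. What is left is the commutator on the
    first two factors, accompanied by k g = h on the others.\<close>
  have *: "?E (Z f) x = Z (?E f) x
      + act_at 1 (?C ** Y - Y ** ?C) (scale (\<lambda>x. prod_list (map h (drop 2 x))) f) x"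
    if "length x = n" for f x
  proof -
    have "Suc (Suc 0) \<le> length x" using that n by simp
    then obtain a b y where x: "x = a # b # y"
      by (auto simp: Suc_le_length_iff)
    have Zf: "Z f (a # b # z) = prod_list (map g z) * act_at 1 Y f (a # b # z)" for a b z f
      by (simp add: Z_def act_at_first scale_def sum_distrib_left mult_ac)
    have mult: "act_at (Suc 0) (A ** B) f (a # b # z) = (\<Sum>q\<in>UNIV. A $ (a, b) $ q * act_at (Suc 0) B f (fst q # snd q # z))"
      for A B :: "'a^('d \<times> 'd)^('d \<times> 'd)" and f a b z
      using act_at_mult[of 1 "a # b # z" A B f] by (simp add: act_at_first[of A])
    have 1: "act_at 1 ?C (Z f) x = prod_list (map g y) * act_at 1 (?C ** Y) f x"
      by (simp add: x mult act_at_first[of ?C] Zf[unfolded One_nat_def] sum_distrib_left mult_ac)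
    have 2: "ladder e k (\<lambda>z. Z f (a # b # z)) y
        = prod_list (map g y) * (\<Sum>q\<in>UNIV. Y $ (a, b) $ q * ladder e k (\<lambda>z. f (fst q # snd q # z)) y)"
      by (simp add: Zf act_at_first[of Y] ladder_scale[OF g] ladder_sum[symmetric])
    have "Z (?E f) x = prod_list (map g y) * (\<Sum>q\<in>UNIV. Y $ (a, b) $ q *
        (prod_list (map k y) * act_at 1 ?C f (fst q # snd q # y) + ladder e k (\<lambda>z. f (fst q # snd q # z)) y))"
      by (simp only: x Zf act_at_first[of Y] One_nat_def ladder_two)
    also have "\<dots> = prod_list (map h y) * act_at 1 (Y ** ?C) f x + ladder e k (\<lambda>z. Z f (a # b # z)) y"
      by (simp add: 2 x mult hkg distrib_left sum.distrib sum_distrib_left mult_ac)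
    finally have 3: "Z (?E f) x = \<dots>" .
    have "?E (Z f) x = prod_list (map h y) * act_at 1 (?C ** Y) f x + ladder e k (\<lambda>z. Z f (a # b # z)) y"
      unfolding x ladder_two using 1 by (simp add: x hkg mult_ac)
    moreover have "act_at 1 (?C ** Y - Y ** ?C) (scale (\<lambda>x. prod_list (map h (drop 2 x))) f) x
      = prod_list (map h y) * (act_at 1 (?C ** Y) f x - act_at 1 (Y ** ?C) f x)"
      unfolding act_at_diff by (simp add: x act_at_first scale_def sum_distrib_left right_diff_distrib mult_ac)
    ultimately show ?thesis using 3 by (simp add: algebra_simps)
  qed
  \<comment> \<open>The operator traced is the commutator of \<open>?E\<close> and \<open>Z\<close>,
    composed with \<open>T\<close>; as \<open>T\<close> commutes with \<open>?E\<close>, cyclicity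
    makes its trace vanish.\<close>
  have "op_trace n (act_at 1 (?C ** Y - Y ** ?C) \<circ> scale (\<lambda>x. prod_list (map h (drop 2 x))) \<circ> T)
      = op_trace n (?E \<circ> (Z \<circ> T)) - op_trace n (Z \<circ> (?E \<circ> T))"
    by (simp add: op_trace_def * sum_subtractf[symmetric] o_def)
  also have "op_trace n (?E \<circ> (Z \<circ> T)) = op_trace n (Z \<circ> T \<circ> ?E)"
    by (intro op_trace_commute linear_on_comp E Z T)
  also have "\<dots> = op_trace n (Z \<circ> (?E \<circ> T))"
    using T(2) by (intro op_trace_cong) (auto intro!: linear_on_cong[OF Z] simp: commute_on_def)
  finally show ?thesis by (simp add: o_def)
qed

section \<open>The R-matrix and quantum sl(2)\<close>

lemma three_eq_zero: "(3::3) = 0"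
  by simp

lemma all_3: "(\<forall>x::3. P x) \<longleftrightarrow> P 0 \<and> P 1 \<and> P 2"
  using forall_3[of P] unfolding three_eq_zero by blast

lemma sum_3_0: "(\<Sum>x\<in>UNIV. f (x::3)) = f 0 + f 1 + f 2"
  unfolding sum_3 three_eq_zero by (simp add: add_ac)

text \<open>Obtained block by block, \<open>ado_R\<close> preserving the sum of the indices. Powers
  of \<open>w\<close> are reduced by w^3 = -1, so \<open>- w\<close> stands for w^(-2) and
  \<open>w^2\<close> for -w^(-1).\<close>

definition ado_R_inv :: "'a::comm_ring_1 \<Rightarrow> 'a \<Rightarrow> 'a \<Rightarrow> 'a^(3 \<times> 3)^(3 \<times> 3)" where
  "ado_R_inv w t u = (\<chi> p q.
     if p = (0, 0) \<and> q = (0, 0) then u^2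
     else if p = (1, 0) \<and> q = (0, 1) then u
     else if p = (0, 1) \<and> q = (1, 0) then u
     else if p = (1, 0) \<and> q = (1, 0) then u^2 - 1
     else if p = (2, 0) \<and> q = (0, 2) then 1
     else if p = (1, 1) \<and> q = (1, 1) then - w
     else if p = (2, 0) \<and> q = (1, 1) then w * (t - u)
     else if p = (0, 2) \<and> q = (2, 0) then 1
     else if p = (1, 1) \<and> q = (2, 0) then w * (w * t + u)
     else if p = (2, 0) \<and> q = (2, 0) then
       - ((t^2 - 1) * (t^2 - w^2) * u^2 + w * (w * t + u) * (t - u))
     else if p = (2, 1) \<and> q = (1, 2) then w^2 * t
     else if p = (1, 2) \<and> q = (2, 1) then w^2 * t
     else if p = (2, 1) \<and> q = (2, 1) then - (1 + w * t^2)
     else if p = (2, 2) \<and> q = (2, 2) then - (w * t^2)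
     else 0)"

text \<open>
  The lowering operator \<open>v\<^sub>i \<mapsto> v\<^sub>i\<^sub>+\<^sub>1\<close> of quantum sl(2) and its group-like companion, which is
  \<open>t\<^sup>-\<^sup>3 h\<close>.
\<close>

definition ado_e :: "('a::comm_ring_1)^3^3" where
  "ado_e = (\<chi> a c. if (a, c) = (1, 0) \<or> (a, c) = (2, 1) then 1 else 0)"

definition ado_k :: "'a::comm_ring_1 \<Rightarrow> 'a \<Rightarrow> 3 \<Rightarrow> 'a" where
  "ado_k w u a = (if a = 0 then u else if a = 1 then w^2 * u else w^4 * u)"

lemma all_pairs_3:
  "(\<forall>p::3 \<times> 3. P p) \<longleftrightarrow> P (0, 0) \<and> P (0, 1) \<and> P (0, 2) \<and> P (1, 0) \<and> P (1, 1) \<and> P (1, 2) \<and>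
     P (2, 0) \<and> P (2, 1) \<and> P (2, 2)"
  by (simp add: split_paired_All all_3)

lemma sum_pairs_3:
  "(\<Sum>q\<in>UNIV. f (q :: 3 \<times> 3)) = f (0, 0) + f (0, 1) + f (0, 2) + f (1, 0) + f (1, 1) + f (1, 2) +
     f (2, 0) + f (2, 1) + f (2, 2)"
  by (simp add: sum_prod_UNIV sum_3_0 add_ac)

lemma inverse_matrix_commute:
  fixes M N C :: "'a::comm_ring_1^'n::finite^'n"
  assumes "M ** N = mat 1" "N ** M = mat 1" "M ** C = C ** M"
  shows "N ** C = C ** N"
proof -
  have "N ** C = N ** (C ** M) ** N"
    by (simp add: assms(1) flip: matrix_mul_assoc)
  also have "\<dots> = C ** N"
    by (simp add: assms(2) matrix_mul_assoc flip: assms(3))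
  finally show ?thesis .
qed

lemma matrix_inv_eqI:
  fixes M N :: "'a::comm_ring_1^'n::finite^'n"
  assumes "M ** N = mat 1" "N ** M = mat 1"
  shows "matrix_inv M = N"
proof -
  have "M ** matrix_inv M = mat 1 \<and> matrix_inv M ** M = mat 1"
    unfolding matrix_inv_def by (rule someI[of _ N]) (simp add: assms)
  then have "matrix_inv M ** (M ** N) = N"
    by (simp add: matrix_mul_assoc)
  then show ?thesis by (simp add: assms)
qed

text \<open>As a rewrite rule next to its assumption, this brings polynomials in \<open>w\<close> to
  degree at most one, modulo the sixth cyclotomic polynomial x^2 - x + 1.\<close>

lemma sixth_root_mult:
  fixes w :: "'a::comm_ring_1"
  assumes "w * w = w - 1"
  shows "w * (w * z) = w * z - z"
  using assms by (simp add: left_diff_distrib flip: mult.assoc)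

context
  fixes w t u :: "'a::comm_ring_1"
  assumes tu: "t * u = 1" and ww: "w * w = w - 1"
begin

private lemma tu_assoc: "t * (u * z) = z"
  by (simp add: tu flip: mult.assoc)

private lemmas ado_simps = tu ww tu_assoc sixth_root_mult[OF ww] power2_eq_square power4_eq_xxxx algebra_simps

lemma ado_R_commute:
  "ado_R w t u ** coproduct ado_e (ado_k w u) = coproduct ado_e (ado_k w u) ** ado_R w t u"
  unfolding vec_eq_iff all_pairs_3 matrix_matrix_mult_def
  by (simp add: sum_pairs_3 coproduct_nth ado_e_def ado_k_def ado_R_def ado_R_image_def axis_def Let_def)
    (simp add: ado_simps)

lemma ado_R_inv_right: "ado_R w t u ** ado_R_inv w t u = mat 1"
  unfolding vec_eq_iff all_pairs_3 matrix_matrix_mult_def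
  by (simp add: sum_pairs_3 ado_R_inv_def ado_R_def ado_R_image_def axis_def mat_def Let_def)
    (simp add: ado_simps)

lemma ado_R_inv_left: "ado_R_inv w t u ** ado_R w t u = mat 1"
  unfolding vec_eq_iff all_pairs_3 matrix_matrix_mult_def
  by (simp add: sum_pairs_3 ado_R_inv_def ado_R_def ado_R_image_def axis_def mat_def Let_def)
    (simp add: ado_simps)

text \<open>The weight of k \<otimes> k at indices a and b is u^2 w^(2(a + b)), and the R-matrix
  preserves a + b.\<close>

lemma ado_R_k:
  assumes "ado_R w t u $ p $ q \<noteq> 0"
  shows "ado_k w u (fst p) * ado_k w u (snd p) = ado_k w u (fst q) * ado_k w u (snd q)"
proof -
  have "\<forall>p q. ado_R w t u $ p $ q = 0 \<or>
      ado_k w u (fst p) * ado_k w u (snd p) = ado_k w u (fst q) * ado_k w u (snd q)"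
    unfolding all_pairs_3 by (simp add: ado_R_def ado_R_image_def axis_def Let_def ado_k_def ado_simps)
  then show ?thesis using assms by blast
qed

lemma ado_R_inv_k:
  assumes "ado_R_inv w t u $ p $ q \<noteq> 0"
  shows "ado_k w u (fst p) * ado_k w u (snd p) = ado_k w u (fst q) * ado_k w u (snd q)"
proof -
  have "\<forall>p q. ado_R_inv w t u $ p $ q = 0 \<or>
      ado_k w u (fst p) * ado_k w u (snd p) = ado_k w u (fst q) * ado_k w u (snd q)"
    unfolding all_pairs_3 by (simp add: ado_R_inv_def ado_k_def ado_simps)
  then show ?thesis using assms by blast
qed

lemma matrix_inv_ado_R: "matrix_inv (ado_R w t u) = ado_R_inv w t u"
  by (rule matrix_inv_eqI) (rule ado_R_inv_right ado_R_inv_left)+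

lemma ado_R_inv_commute:
  "ado_R_inv w t u ** coproduct ado_e (ado_k w u) = coproduct ado_e (ado_k w u) ** ado_R_inv w t u"
  by (rule inverse_matrix_commute[OF ado_R_inv_right ado_R_inv_left ado_R_commute])

end

section \<open>The operator invariant is a scalar\<close>

text \<open>
  Each letter of the braid is represented by its own matrix, so that the same operators can be
  used for graded and specialised versions of the \<open>R\<close>-matrix.
\<close>

definition letter_word :: "'m \<Rightarrow> 'm \<Rightarrow> artin list \<Rightarrow> (nat \<times> 'm) list" where
  "letter_word M N \<beta> = map (\<lambda>a. (artin_index a, case a of Gen _ \<Rightarrow> M | GenInv _ \<Rightarrow> N)) \<beta>"

lemma braid_op_eq_word_op: "braid_op R \<beta> = word_op (letter_word R (matrix_inv R) \<beta>)"
proof (induction \<beta>)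
  case (Cons a \<beta>)
  then show ?case by (cases a) (auto simp: letter_word_def)
qed (simp add: letter_word_def)

lemma letter_word_ball:
  assumes "braid_word n \<beta>" "\<And>i. 1 \<le> i \<Longrightarrow> i < n \<Longrightarrow> P i M" "\<And>i. 1 \<le> i \<Longrightarrow> i < n \<Longrightarrow> P i N"
  shows "\<forall>(i, X)\<in>set (letter_word M N \<beta>). 1 \<le> i \<and> i < n \<and> P i X"
  using assms by (auto simp: letter_word_def braid_word_def split: artin.split)

lemma linear_on_letter_word: "braid_word n \<beta> \<Longrightarrow> linear_on n (word_op (letter_word M N \<beta>))"
  by (rule linear_on_word_op) (auto simp: letter_word_def braid_word_def)

lemma sum_list_pair_update:
  fixes \<phi> :: "'d \<Rightarrow> 'b::ab_group_add"
  assumes i: "1 \<le> i" "i < length x"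
  shows "sum_list (map \<phi> (x[i - 1 := c, i := d])) + (\<phi> (x ! (i - 1)) + \<phi> (x ! i)) =
    sum_list (map \<phi> x) + (\<phi> c + \<phi> d)"
proof -
  have "sum_list (map \<phi> x) =
      sum_list (map \<phi> (take (i - 1) x)) + (\<phi> (x ! (i - 1)) + \<phi> (x ! i)) + sum_list (map \<phi> (drop (Suc i) x))"
    by (subst list_pair_split[OF i]) (simp add: add_ac)
  then show ?thesis
    by (simp only: list_pair_update[OF i]) (simp add: add_ac)
qed

text \<open>Columns are inputs and rows are outputs, so no letter raises the total degree. Applied
  to a degree and to its negative, this is conservation of the degree; applied to one alone, it is
  triangularity.\<close>

lemma word_op_mono:
  fixes \<phi> :: "'d::finite \<Rightarrow> int" and w :: "(nat \<times> ('a::comm_ring_1^('d \<times> 'd)^('d \<times> 'd))) list"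
  assumes "\<forall>(i, M)\<in>set w. 1 \<le> i \<and> i < n \<and>
      (\<forall>p q. M $ p $ q \<noteq> 0 \<longrightarrow> \<phi> (fst p) + \<phi> (snd p) \<le> \<phi> (fst q) + \<phi> (snd q))"
    and "length x = n" "word_op w (pure_tensor y) x \<noteq> 0"
  shows "sum_list (map \<phi> x) \<le> sum_list (map \<phi> y)"
  using assms
proof (induction w arbitrary: x rule: word_op.induct)
  case 1
  then show ?case by (auto simp: pure_tensor_def split: if_splits)
next
  case (2 i M w)
  then have i: "1 \<le> i" "i < length x" by auto
  obtain q where q: "M $ (x ! (i - 1), x ! i) $ q \<noteq> 0"
    "word_op w (pure_tensor y) (x[i - 1 := fst q, i := snd q]) \<noteq> 0"
    using 2(4) unfolding word_op.simps comp_apply act_at_eq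
    by (metis (no_types, lifting) mult_zero_left mult_zero_right sum.not_neutral_contains_not_neutral)
  have "sum_list (map \<phi> (x[i - 1 := fst q, i := snd q])) \<le> sum_list (map \<phi> y)"
    using 2 q(2) by (intro "2.IH") auto
  moreover have "\<phi> (x ! (i - 1)) + \<phi> (x ! i) \<le> \<phi> (fst q) + \<phi> (snd q)"
    using 2(2) q(1) by fastforce
  ultimately show ?case
    using sum_list_pair_update[OF i, of \<phi> "fst q" "snd q"] by linarith
qed

section \<open>Partial traces as full traces\<close>

lemma id_tensor_h_diag:
  fixes h :: "'a::comm_ring_1^'d::finite^'d"
  assumes h: "\<And>a c. h $ a $ c = (if a = c then d a else 0)" and x: "length x = n" "1 \<le> n"
  shows "id_tensor_h n h f x = prod_list (map d (tl x)) * f x"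
proof -
  have "(\<Prod>k\<in>{1..<n}. h $ (x ! k) $ (y ! k)) = (if y = x then prod_list (map d (tl x)) else 0)"
    if y: "length y = n" "y ! 0 = x ! 0" for y
  proof (cases "y = x")
    case True
    have "prod_list (map d (tl x)) = (\<Prod>k\<in>{0..<n - 1}. d (x ! Suc k))"
      using x by (simp add: prod_list_def prod.list_conv_set_nth nth_tl flip: prod_list_def)
    also have "\<dots> = (\<Prod>k\<in>{1..<n}. d (x ! k))"
      using x prod.shift_bounds_Suc_ivl[of "\<lambda>k. d (x ! k)" 0 "n - 1"] by simp
    finally show ?thesis using True by (simp add: h)
  next
    case False
    then obtain k where k: "k < n" "y ! k \<noteq> x ! k"
      using y x by (metis nth_equalityI)
    then have "k \<in> {1..<n}" using y by (cases k) auto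
    then show ?thesis using k False by (auto simp: h intro!: prod_zero bexI[of _ k])
  qed
  then have "id_tensor_h n h f x
      = (\<Sum>y | length y = n \<and> y ! 0 = x ! 0. if y = x then prod_list (map d (tl x)) * f x else 0)"
    unfolding id_tensor_h_def by (intro sum.cong) auto
  also have "\<dots> = prod_list (map d (tl x)) * f x"
    using x by (subst sum.delta) (auto intro: finite_subset[OF _ finite_lists_of_length[of n]])
  finally show ?thesis .
qed

lemma operator_invariant_nth:
  fixes h :: "'a::comm_ring_1^'d::finite^'d"
  assumes h: "\<And>a c. h $ a $ c = (if a = c then d a else 0)" and n: "1 \<le> n"
  shows "operator_invariant R h n \<beta> $ i $ j =
    (\<Sum>a | length a = n - 1. prod_list (map d a) * braid_op R \<beta> (pure_tensor (j # a)) (i # a))"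
  unfolding operator_invariant_def partial_trace_def
  by (simp, rule sum.cong) (use n in \<open>auto simp: id_tensor_h_diag[OF h]\<close>)

lemma nth_Cons_tl: "1 \<le> length x \<Longrightarrow> x ! 0 # tl x = x"
  by (cases x) auto

text \<open>Expresses a diagonal entry of a partial trace as a full trace, for which cyclicity is
  available.\<close>

lemma op_trace_first:
  fixes A :: "('a::comm_ring_1, 'd::finite) tensor \<Rightarrow> ('a, 'd) tensor"
  assumes n: "1 \<le> n"
  shows "op_trace n (scale (\<lambda>x. if x ! 0 = i then v x else 0) \<circ> A) =
    (\<Sum>a | length a = n - 1. v (i # a) * A (pure_tensor (i # a)) (i # a))"
proof -
  have "op_trace n (scale (\<lambda>x. if x ! 0 = i then v x else 0) \<circ> A)
      = (\<Sum>x | length x = n \<and> x ! 0 = i. v x * A (pure_tensor x) x)"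
    unfolding op_trace_def scale_def
    by (rule sum.mono_neutral_cong_right) auto
  also have "\<dots> = (\<Sum>a | length a = n - 1. v (i # a) * A (pure_tensor (i # a)) (i # a))"
    by (rule sum.reindex_bij_witness[where i = "\<lambda>a. i # a" and j = tl])
      (use n in \<open>auto simp: nth_Cons_tl\<close>)
  finally show ?thesis .
qed

text \<open>The weight of the second factor is absorbed in the matrix on the first two factors,
  which gives the trace the shape required by \<open>op_trace_commutator\<close>.\<close>

lemma op_trace_unit:
  fixes T :: "('a::comm_ring_1, 'd::finite) tensor \<Rightarrow> ('a, 'd) tensor"
  assumes n: "2 \<le> n"
  shows "op_trace n (act_at 1 (\<chi> p q. if p = q \<and> fst p = i then d (snd p) else 0)
      \<circ> scale (\<lambda>x. prod_list (map d (drop 2 x))) \<circ> T) =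
    (\<Sum>a | length a = n - 1. prod_list (map d a) * T (pure_tensor (i # a)) (i # a))"
proof -
  have "op_trace n (act_at 1 (\<chi> p q. if p = q \<and> fst p = i then d (snd p) else 0)
      \<circ> scale (\<lambda>x. prod_list (map d (drop 2 x))) \<circ> T)
    = op_trace n (scale (\<lambda>x. if x ! 0 = i then prod_list (map d (tl x)) else 0) \<circ> T)"
  proof (rule op_trace_cong)
    fix f and x :: "'d list" assume "length x = n"
    then have "Suc (Suc 0) \<le> length x" using n by simp
    then obtain a b y where x: "x = a # b # y"
      by (auto simp: Suc_le_length_iff)
    have "(\<Sum>q\<in>UNIV. (if (i, b) = q then d (snd q) else 0) * g q) = d b * g (i, b)"
      for g :: "'d \<times> 'd \<Rightarrow> 'a"
      by (simp add: if_distrib[of "\<lambda>z. z * _"] cong: if_cong)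
    then show "(act_at 1 (\<chi> p q. if p = q \<and> fst p = i then d (snd p) else 0)
        \<circ> scale (\<lambda>x. prod_list (map d (drop 2 x))) \<circ> T) f x
      = (scale (\<lambda>x. if x ! 0 = i then prod_list (map d (tl x)) else 0) \<circ> T) f x"
      by (simp add: x act_at_first scale_def cong: if_cong)
  qed
  also have "\<dots> = (\<Sum>a | length a = n - 1. prod_list (map d a) * T (pure_tensor (i # a)) (i # a))"
    using op_trace_first[of n i "\<lambda>x. prod_list (map d (tl x))" T] n by simp
  finally show ?thesis .
qed

definition ado_d :: "'a::comm_ring_1 \<Rightarrow> 'a \<Rightarrow> 3 \<Rightarrow> 'a" where
  "ado_d w t a = (if a = 0 then t^2 else if a = 1 then t^2 * w^2 else t^2 * w^4)"

text \<open>The index has to be read in the integers, since addition in the type \<open>3\<close> is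
  modulo 3.\<close>

definition ado_degree :: "3 \<Rightarrow> int" where
  "ado_degree a = (if a = 0 then 0 else if a = 1 then 1 else 2)"

lemma ado_degree_inj: "inj ado_degree"
proof -
  have "\<forall>a b. ado_degree a = ado_degree b \<longrightarrow> a = b"
    unfolding all_3 by (simp add: ado_degree_def)
  then show ?thesis by (simp add: inj_def)
qed

lemma ado_h_nth: "ado_h w t $ a $ c = (if a = c then ado_d w t a else 0)"
  by (simp add: ado_h_def ado_d_def)

lemma ado_R_degree:
  "ado_R w t u $ p $ q \<noteq> 0 \<Longrightarrow>
    ado_degree (fst p) + ado_degree (snd p) = ado_degree (fst q) + ado_degree (snd q)"
proof -
  have "\<forall>p q. ado_R w t u $ p $ q = 0 \<or>
      ado_degree (fst p) + ado_degree (snd p) = ado_degree (fst q) + ado_degree (snd q)"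
    unfolding all_pairs_3 by (simp add: ado_R_def ado_R_image_def axis_def Let_def ado_degree_def)
  then show "ado_R w t u $ p $ q \<noteq> 0 \<Longrightarrow> ?thesis" by blast
qed

lemma ado_R_inv_degree:
  "ado_R_inv w t u $ p $ q \<noteq> 0 \<Longrightarrow>
    ado_degree (fst p) + ado_degree (snd p) = ado_degree (fst q) + ado_degree (snd q)"
proof -
  have "\<forall>p q. ado_R_inv w t u $ p $ q = 0 \<or>
      ado_degree (fst p) + ado_degree (snd p) = ado_degree (fst q) + ado_degree (snd q)"
    unfolding all_pairs_3 by (simp add: ado_R_inv_def ado_degree_def)
  then show "ado_R_inv w t u $ p $ q \<noteq> 0 \<Longrightarrow> ?thesis" by blast
qed

definition ado_word :: "'a::comm_ring_1 \<Rightarrow> 'a \<Rightarrow> 'a \<Rightarrow> artin list \<Rightarrow> (nat \<times> ('a^(3 \<times> 3)^(3 \<times> 3))) list" where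
  "ado_word w t u = letter_word (ado_R w t u) (ado_R_inv w t u)"

text \<open>Conservation of the degree kills the entries off the diagonal, and neighbouring diagonal
  entries differ by the trace of a commutator. Hence the index \<open>s\<close> at which the scalar
  is read is arbitrary.\<close>

lemma operator_invariant_ado_scalar:
  fixes w t u :: "'a::comm_ring_1"
  assumes tu: "t * u = 1" and ww: "w * w = w - 1" and n: "2 \<le> n" and \<beta>: "braid_word n \<beta>"
  defines "T \<equiv> word_op (ado_word w t u \<beta>)"
  shows "operator_invariant (ado_R w t u) (ado_h w t) n \<beta> $ i $ j =
    (if i = j then \<Sum>a | length a = n - 1. prod_list (map (ado_d w t) a) * T (pure_tensor (s # a)) (s # a)
     else 0)"
proof -
  let ?c = "\<lambda>i. \<Sum>a | length a = n - 1. prod_list (map (ado_d w t) a) * T (pure_tensor (i # a)) (i # a)"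
  let ?C = "coproduct ado_e (ado_k w u)"
  have entry: "operator_invariant (ado_R w t u) (ado_h w t) n \<beta> $ i $ j =
      (\<Sum>a | length a = n - 1. prod_list (map (ado_d w t) a) * T (pure_tensor (j # a)) (i # a))" for i j
    using n by (subst operator_invariant_nth[OF ado_h_nth])
      (simp_all add: T_def ado_word_def braid_op_eq_word_op matrix_inv_ado_R[OF tu ww])
  have "T (pure_tensor (j # a)) (i # a) = 0" if "i \<noteq> j" "length a = n - 1" for i j a
  proof (rule ccontr)
    assume nz: "T (pure_tensor (j # a)) (i # a) \<noteq> 0"
    have *: "sum_list (map \<phi> (i # a)) \<le> sum_list (map \<phi> (j # a))"
      if "\<phi> = ado_degree \<or> \<phi> = (\<lambda>x. - ado_degree x)" for \<phi>
    proof (rule word_op_mono[OF _ _ nz[unfolded T_def ado_word_def]])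
      show "\<forall>(i, M)\<in>set (letter_word (ado_R w t u) (ado_R_inv w t u) \<beta>). 1 \<le> i \<and> i < n \<and>
          (\<forall>p q. M $ p $ q \<noteq> 0 \<longrightarrow> \<phi> (fst p) + \<phi> (snd p) \<le> \<phi> (fst q) + \<phi> (snd q))"
        using that ado_R_degree[of w t u] ado_R_inv_degree[of w t u]
        by (intro letter_word_ball[OF \<beta>]) (auto simp: algebra_simps)
    qed (use \<open>length a = n - 1\<close> n in auto)
    from *[of ado_degree] *[of "\<lambda>x. - ado_degree x"] have "ado_degree i = ado_degree j"
      by (simp add: uminus_sum_list_map)
    then show False
      using \<open>i \<noteq> j\<close> ado_degree_inj by (simp add: inj_eq)
  qed
  moreover have "?c i = ?c j" for i j
  proof -
    have T: "linear_on n T"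
      unfolding T_def ado_word_def
      by (rule linear_on_letter_word[OF \<beta>])
    have comm: "commute_on n T (ladder ado_e (ado_k w u))"
      unfolding T_def ado_word_def
      by (intro commute_on_word_op letter_word_ball[OF \<beta>])
        (auto simp: commute_on_def intro!: act_at_ladder[OF ado_R_commute[OF tu ww] ado_R_k[OF tu ww]]
          act_at_ladder[OF ado_R_inv_commute[OF tu ww] ado_R_inv_k[OF tu ww]])
    have ut: "ado_d w t a = ado_k w u a * t^3" for a
      using tu by (simp add: ado_d_def ado_k_def power2_eq_square power3_eq_cube)
        (metis (no_types, lifting) mult.assoc mult.commute mult.right_neutral)
    define U :: "3 \<Rightarrow> 'a^(3 \<times> 3)^(3 \<times> 3)"
      where "U i = (\<chi> p q. if p = q \<and> fst p = i then ado_d w t (snd p) else 0)" for i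
    have step: "?c i = ?c j" if "(i, j) = (0, 1) \<or> (i, j) = (1, 2)" for i j
    proof -
      \<comment> \<open>This is t^3 E_ij \<otimes> 1. It commutes with the summand 1 \<otimes> e of
        the coproduct; for the other summand, [e, E_ij] = E_jj - E_ii for these neighbouring
        indices, and t^3 k = h.\<close>
      define Y :: "'a^(3 \<times> 3)^(3 \<times> 3)"
        where "Y = (\<chi> p q. if fst p = i \<and> fst q = j \<and> snd p = snd q then t^3 else 0)"
      have eq: "?C ** Y - Y ** ?C = U j - U i"
        using that unfolding vec_eq_iff all_pairs_3 matrix_matrix_mult_def
        by (elim disjE) (simp_all add: sum_pairs_3 coproduct_nth ado_e_def Y_def U_def ut)
      have "op_trace n (act_at 1 (?C ** Y - Y ** ?C) \<circ> scale (\<lambda>x. prod_list (map (ado_d w t) (drop 2 x))) \<circ> T) = 0"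
        by (rule op_trace_commutator[OF n T comm ut]) simp
      then have "op_trace n (act_at 1 (U j) \<circ> scale (\<lambda>x. prod_list (map (ado_d w t) (drop 2 x))) \<circ> T)
          = op_trace n (act_at 1 (U i) \<circ> scale (\<lambda>x. prod_list (map (ado_d w t) (drop 2 x))) \<circ> T)"
        unfolding eq by (simp add: op_trace_def act_at_diff sum_subtractf)
      then show ?thesis
        unfolding U_def op_trace_unit[OF n] by simp
    qed
    show ?thesis
      using step[of 0 1] step[of 1 2] all_pairs_3[of "\<lambda>(i, j). ?c i = ?c j"] by simp
  qed
  ultimately show ?thesis
    unfolding entry by (auto intro!: sum.neutral)
qed

section \<open>Evaluation of Laurent polynomials\<close>

lemma laurent_eval_superset:
  "finite K \<Longrightarrow> Poly_Mapping.keys p \<subseteq> K \<Longrightarrow>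
    laurent_eval p z = (\<Sum>k\<in>K. Poly_Mapping.lookup p k * z powi k)"
  unfolding laurent_eval_def by (rule sum.mono_neutral_left) (auto simp: in_keys_iff)

lemma laurent_eval_add: "laurent_eval (p + q) z = laurent_eval p z + laurent_eval q z"
proof -
  let ?K = "Poly_Mapping.keys p \<union> Poly_Mapping.keys q"
  have "Poly_Mapping.keys (p + q) \<subseteq> ?K" by (rule keys_add)
  then show ?thesis
    by (simp add: laurent_eval_superset[of ?K] lookup_add distrib_right sum.distrib)
qed

lemma laurent_eval_single: "laurent_eval (Poly_Mapping.single k c) z = c * z powi k"
  by (simp add: laurent_eval_superset[of "{k}"])

lemma laurent_induct [case_names single add]:
  fixes p :: laurent
  assumes "\<And>k c. P (Poly_Mapping.single k c)" "\<And>p q. P p \<Longrightarrow> P q \<Longrightarrow> P (p + q)"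
  shows "P p"
proof (induction p rule: update_induct)
  case const
  show ?case using assms(1)[of 0 0] by simp
next
  case (update p k c)
  have "Poly_Mapping.update k c p = p + Poly_Mapping.single k c"
    using update by (intro poly_mapping_eqI) (auto simp: lookup_update lookup_add lookup_single in_keys_iff)
  then show ?case using assms(2)[OF update(3) assms(1)] by simp
qed

lemma laurent_eval_mult:
  assumes "z \<noteq> 0"
  shows "laurent_eval (p * q) z = laurent_eval p z * laurent_eval q z"
proof (induction p rule: laurent_induct)
  case (single k c)
  show ?case
    by (induction q rule: laurent_induct)
      (simp_all add: laurent_eval_add laurent_eval_single mult_single power_int_add assms distrib_left)
qed (simp add: laurent_eval_add distrib_right)

section \<open>Specialisation to t = 1 and t = omega\<close>

lemma omega_square: "omega * omega = omega - 1"
proof -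
  have "omega = cis (pi / 3)"
    by (simp add: omega_def cis_conv_exp)
  then have *: "omega = Complex (1 / 2) (sqrt 3 / 2)"
    by (simp add: complex_eq_iff cos_60 sin_60)
  show ?thesis
    unfolding * by (simp add: complex_eq_iff)
qed

lemma omega_nonzero: "omega \<noteq> 0"
  by (simp add: omega_def)

locale ring_hom_1 =
  fixes \<phi> :: "'a::comm_ring_1 \<Rightarrow> 'b::comm_ring_1"
  assumes hom_one: "\<phi> 1 = 1" and hom_add: "\<phi> (x + y) = \<phi> x + \<phi> y" and hom_mult: "\<phi> (x * y) = \<phi> x * \<phi> y"
begin

lemma hom_zero: "\<phi> 0 = 0"
  using hom_add[of 0 0] by simp

lemma hom_diff: "\<phi> (x - y) = \<phi> x - \<phi> y"
  using hom_add[of "x - y" y] by simp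

lemma hom_uminus: "\<phi> (- x) = - \<phi> x"
  using hom_diff[of 0 x] by (simp add: hom_zero)

lemma hom_power: "\<phi> (x ^ k) = \<phi> x ^ k"
  by (induction k) (simp_all add: hom_one hom_mult)

lemma hom_sum: "\<phi> (sum f A) = (\<Sum>x\<in>A. \<phi> (f x))"
  by (induction A rule: infinite_finite_induct) (simp_all add: hom_zero hom_add)

lemma hom_prod_list: "\<phi> (prod_list xs) = prod_list (map \<phi> xs)"
  by (induction xs) (simp_all add: hom_one hom_mult)

lemmas hom_simps = hom_zero hom_one hom_add hom_diff hom_uminus hom_mult hom_power

lemma hom_word_op:
  assumes "\<And>p q. \<phi> (M $ p $ q) = M' $ p $ q" "\<And>p q. \<phi> (N $ p $ q) = N' $ p $ q"
  shows "\<phi> (word_op (letter_word M N \<beta>) (pure_tensor y) x) =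
    word_op (letter_word M' N' \<beta>) (pure_tensor y) x"
proof (induction \<beta> arbitrary: x)
  case Nil
  then show ?case by (simp add: letter_word_def pure_tensor_def hom_zero hom_one)
next
  case (Cons a \<beta>)
  then show ?case
    by (cases a) (simp_all add: letter_word_def act_at_eq hom_sum hom_mult assms)
qed

lemma hom_ado_R: "\<phi> (ado_R w t u $ p $ q) = ado_R (\<phi> w) (\<phi> t) (\<phi> u) $ p $ q"
proof -
  have "\<forall>p q. \<phi> (ado_R w t u $ p $ q) = ado_R (\<phi> w) (\<phi> t) (\<phi> u) $ p $ q"
    unfolding all_pairs_3 by (simp add: ado_R_def ado_R_image_def axis_def Let_def hom_simps)
  then show ?thesis by blast
qed

lemma hom_ado_R_inv: "\<phi> (ado_R_inv w t u $ p $ q) = ado_R_inv (\<phi> w) (\<phi> t) (\<phi> u) $ p $ q"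
proof -
  have "\<forall>p q. \<phi> (ado_R_inv w t u $ p $ q) = ado_R_inv (\<phi> w) (\<phi> t) (\<phi> u) $ p $ q"
    unfolding all_pairs_3 by (simp add: ado_R_inv_def hom_simps)
  then show ?thesis by blast
qed

lemma hom_ado_d: "\<phi> (ado_d w t a) = ado_d (\<phi> w) (\<phi> t) a"
  by (simp add: ado_d_def hom_simps)

end

lemma laurent_eval_hom: "z \<noteq> 0 \<Longrightarrow> ring_hom_1 (\<lambda>p. laurent_eval p z)"
  using laurent_eval_single[of 0 1 z]
  by unfold_locales (simp_all add: laurent_eval_add laurent_eval_mult)

text \<open>The index \<open>s\<close> remains free because the transparent vector, at which the
  trace will be read, has index 0 for t = 1 and index 2 for t = \<omega>.\<close>

lemma laurent_eval_ADO3: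
  assumes n: "2 \<le> n" and \<beta>: "braid_word n \<beta>" and z: "z \<noteq> 0"
  shows "laurent_eval (ADO3 n \<beta>) z = (\<Sum>a | length a = n - 1. prod_list (map (ado_d omega z) a)
    * word_op (ado_word omega z (1 / z) \<beta>) (pure_tensor (s # a)) (s # a))"
proof -
  interpret ring_hom_1 "\<lambda>p. laurent_eval p z" using z by (rule laurent_eval_hom)
  define w where "w = laurent_const omega"
  define t u :: laurent where "t = Poly_Mapping.single 1 1" and "u = Poly_Mapping.single (-1) 1"
  have tu: "t * u = 1" by (simp add: t_def u_def mult_single)
  have ww: "w * w = w - 1"
    by (simp add: w_def laurent_const_def mult_single omega_square single_diff)
  define c where "c = (\<Sum>a | length a = n - 1. prod_list (map (ado_d w t) a)
    * word_op (ado_word w t u \<beta>) (pure_tensor (s # a)) (s # a))"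
  have "ado_operator n \<beta> = mat c"
    using operator_invariant_ado_scalar[OF tu ww n \<beta>, of _ _ s]
    by (simp add: ado_operator_def Let_def vec_eq_iff mat_def c_def flip: w_def t_def u_def)
  moreover have "c' = c" if "mat c' = (mat c :: laurent^3^3)" for c'
    using arg_cong[OF that, of "\<lambda>A. A $ 0 $ 0"] by (simp add: mat_def)
  ultimately have "ADO3 n \<beta> = c"
    unfolding ADO3_def by (intro the_equality) auto
  moreover have "laurent_eval w z = omega" "laurent_eval t z = z" "laurent_eval u z = 1 / z"
    by (simp_all add: w_def t_def u_def laurent_const_def laurent_eval_single power_int_minus divide_inverse)
  ultimately show ?thesis
    by (simp add: c_def hom_sum hom_mult hom_prod_list hom_ado_d ado_word_def o_def
        hom_word_op[OF hom_ado_R hom_ado_R_inv])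
qed

text \<open>
  Conjugation with this diagonal operator multiplies by \<open>\<epsilon> = \<plusminus>1\<close> the matrix entries that
  interchange neighbouring factors exactly one of which is \<open>m\<close>.
\<close>

definition gauge :: "'a::comm_ring_1 \<Rightarrow> 'd \<Rightarrow> 'd list \<Rightarrow> 'a" where
  "gauge \<epsilon> m x = (\<Prod>j<length x. if x ! j = m then \<epsilon> ^ j else 1)"

lemma gauge_square:
  assumes "\<epsilon> * \<epsilon> = 1"
  shows "gauge \<epsilon> m x * gauge \<epsilon> m x = 1"
  using assms by (auto simp: gauge_def prod.distrib[symmetric] power_mult_distrib[symmetric] intro!: prod.neutral)

text \<open>If the entry \<open>m\<close> moves between positions l and l + 1, these contribute an
  odd power \<epsilon>^(2l+1) = \<epsilon>. All other contributions are squares.\<close>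

lemma gauge_pair_update:
  assumes \<epsilon>: "\<epsilon> * \<epsilon> = 1" and i: "1 \<le> i" "i < length x"
    and eq: "of_bool (x ! (i - 1) = m) + of_bool (x ! i = m) = (of_bool (c = m) + of_bool (d = m) :: nat)"
  shows "gauge \<epsilon> m x * gauge \<epsilon> m (x[i - 1 := c, i := d]) =
    (if (x ! (i - 1) = m) \<noteq> (c = m) then \<epsilon> else 1)"
proof -
  define l where "l = i - 1"
  have l: "i = Suc l" "Suc l < length x" using i by (auto simp: l_def)
  let ?z = "x[l := c, Suc l := d]"
  let ?g = "\<lambda>j a. if a = m then \<epsilon> ^ j else 1"
  have sq: "\<epsilon> ^ k * \<epsilon> ^ k = 1" for k
    using \<epsilon> by (simp flip: power_mult_distrib)
  have "gauge \<epsilon> m x * gauge \<epsilon> m ?z = (\<Prod>j<length x. ?g j (x ! j) * ?g j (?z ! j))"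
    by (simp add: gauge_def prod.distrib)
  also have "\<dots> = (\<Prod>j\<in>{l, Suc l}. ?g j (x ! j) * ?g j (?z ! j))"
    by (rule prod.mono_neutral_right) (use l in \<open>auto simp: sq nth_list_update\<close>)
  also have "\<dots> = (if (x ! l = m) \<noteq> (c = m) then \<epsilon> else 1)"
    using eq l sq[of l] sq[of "Suc l"] \<epsilon>
    by (auto simp: nth_list_update of_bool_def mult_ac split: if_splits)
  finally show ?thesis by (simp add: l)
qed

text \<open>
  \<open>M\<close> does not raise the degree \<open>\<phi>\<close> from column to row, and \<open>M'\<close> is its degree-preserving part,
  up to the relabelling \<open>\<rho>\<close> of the basis and the gauge transformation.
\<close>

definition graded_part ::
    "('d \<Rightarrow> int) \<Rightarrow> ('d \<Rightarrow> 'd) \<Rightarrow> 'd \<Rightarrow> 'a \<Rightarrow> 'a^('d \<times> 'd)^('d \<times> 'd)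
      \<Rightarrow> ('a::comm_ring_1)^('d::finite \<times> 'd)^('d \<times> 'd) \<Rightarrow> bool" where
  "graded_part \<phi> \<rho> m \<epsilon> M M' \<longleftrightarrow> (\<forall>p q.
     let eq = \<phi> (fst p) + \<phi> (snd p) = \<phi> (fst q) + \<phi> (snd q);
         M'pq = M' $ (\<rho> (fst p), \<rho> (snd p)) $ (\<rho> (fst q), \<rho> (snd q))
     in (M $ p $ q = 0 \<or> \<phi> (fst p) + \<phi> (snd p) \<le> \<phi> (fst q) + \<phi> (snd q)) \<and>
       (M'pq = 0 \<or> eq \<and> of_bool (fst p = m) + of_bool (snd p = m) =
         (of_bool (fst q = m) + of_bool (snd q = m) :: nat)) \<and>
       (eq \<longrightarrow> M $ p $ q = (if (fst p = m) \<noteq> (fst q = m) then \<epsilon> else 1) * M'pq))"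

lemma graded_partD:
  assumes "graded_part \<phi> \<rho> m \<epsilon> M M'"
  shows "M $ p $ q \<noteq> 0 \<Longrightarrow> \<phi> (fst p) + \<phi> (snd p) \<le> \<phi> (fst q) + \<phi> (snd q)"
    and "M' $ (\<rho> (fst p), \<rho> (snd p)) $ (\<rho> (fst q), \<rho> (snd q)) \<noteq> 0 \<Longrightarrow>
      \<phi> (fst p) + \<phi> (snd p) = \<phi> (fst q) + \<phi> (snd q)"
    and "M' $ (\<rho> (fst p), \<rho> (snd p)) $ (\<rho> (fst q), \<rho> (snd q)) \<noteq> 0 \<Longrightarrow>
      of_bool (fst p = m) + of_bool (snd p = m) = (of_bool (fst q = m) + of_bool (snd q = m) :: nat)"
    and "\<phi> (fst p) + \<phi> (snd p) = \<phi> (fst q) + \<phi> (snd q) \<Longrightarrow>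
      M $ p $ q = (if (fst p = m) \<noteq> (fst q = m) then \<epsilon> else 1) *
        M' $ (\<rho> (fst p), \<rho> (snd p)) $ (\<rho> (fst q), \<rho> (snd q))"
  using assms unfolding graded_part_def Let_def by blast+

text \<open>A loss of degree at one letter cannot be made up at another. Between lists of equal
  degree only the degree-preserving entries contribute, and the gauge factors of the intermediate
  lists cancel in pairs.\<close>

lemma word_op_graded:
  fixes M M' N N' :: "'a::comm_ring_1^('d::finite \<times> 'd)^('d \<times> 'd)"
  assumes M: "graded_part \<phi> \<rho> m \<epsilon> M M'" and N: "graded_part \<phi> \<rho> m \<epsilon> N N'"
    and \<epsilon>: "\<epsilon> * \<epsilon> = 1" and \<rho>: "bij \<rho>" and \<beta>: "braid_word n \<beta>" and x: "length x = n"
    and deg: "sum_list (map \<phi> x) = sum_list (map \<phi> y)"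
  shows "word_op (letter_word M N \<beta>) (pure_tensor y) x = gauge \<epsilon> m x * gauge \<epsilon> m y *
    word_op (letter_word M' N' \<beta>) (pure_tensor (map \<rho> y)) (map \<rho> x)"
  using \<beta> x deg
proof (induction \<beta> arbitrary: x)
  case Nil
  then show ?case
    using gauge_square[OF \<epsilon>] \<rho> by (auto simp: letter_word_def pure_tensor_def inj_map_eq_map bij_is_inj)
next
  case (Cons a \<beta>)
  define i where "i = artin_index a"
  define A where "A = (case a of Gen _ \<Rightarrow> M | GenInv _ \<Rightarrow> N)"
  define A' where "A' = (case a of Gen _ \<Rightarrow> M' | GenInv _ \<Rightarrow> N')"
  define T where "T = word_op (letter_word M N \<beta>) (pure_tensor y)"
  define T' where "T' = word_op (letter_word M' N' \<beta>) (pure_tensor (map \<rho> y))"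
  have i: "1 \<le> i" "i < length x" and \<beta>: "braid_word n \<beta>"
    using Cons.prems by (auto simp: braid_word_def i_def)
  have A: "graded_part \<phi> \<rho> m \<epsilon> A A'"
    using M N by (auto simp: A_def A'_def split: artin.split)
  have mono: "\<forall>(i, X)\<in>set (letter_word M N \<beta>). 1 \<le> i \<and> i < n \<and>
      (\<forall>p q. X $ p $ q \<noteq> 0 \<longrightarrow> \<phi> (fst p) + \<phi> (snd p) \<le> \<phi> (fst q) + \<phi> (snd q))"
    using graded_partD(1)[OF M] graded_partD(1)[OF N] by (intro letter_word_ball[OF \<beta>]) auto
  let ?p = "(x ! (i - 1), x ! i)"
  have termwise: "A $ ?p $ q * T (x[i - 1 := fst q, i := snd q]) = gauge \<epsilon> m x * gauge \<epsilon> m y *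
      (A' $ (\<rho> (x ! (i - 1)), \<rho> (x ! i)) $ (\<rho> (fst q), \<rho> (snd q)) *
        T' (map \<rho> (x[i - 1 := fst q, i := snd q])))" for q
  proof -
    let ?z = "x[i - 1 := fst q, i := snd q]"
    let ?a' = "A' $ (\<rho> (x ! (i - 1)), \<rho> (x ! i)) $ (\<rho> (fst q), \<rho> (snd q))"
    have z: "length ?z = n" using Cons.prems by simp
    have sum_z: "sum_list (map \<phi> ?z) + (\<phi> (x ! (i - 1)) + \<phi> (x ! i)) =
        sum_list (map \<phi> x) + (\<phi> (fst q) + \<phi> (snd q))"
      by (rule sum_list_pair_update[OF i])
    show ?thesis
    proof (cases "\<phi> (x ! (i - 1)) + \<phi> (x ! i) = \<phi> (fst q) + \<phi> (snd q)")
      case True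
      have IH: "T ?z = gauge \<epsilon> m ?z * gauge \<epsilon> m y * T' (map \<rho> ?z)"
        unfolding T_def T'_def using \<beta> z True sum_z Cons.prems by (intro Cons.IH) auto
      have a: "A $ ?p $ q = (if (x ! (i - 1) = m) \<noteq> (fst q = m) then \<epsilon> else 1) * ?a'"
        using graded_partD(4)[OF A, of ?p q] True by simp
      show ?thesis
      proof (cases "?a' = 0")
        case False
        have s: "gauge \<epsilon> m x * gauge \<epsilon> m ?z = (if (x ! (i - 1) = m) \<noteq> (fst q = m) then \<epsilon> else 1)"
          using graded_partD(3)[OF A, of ?p q] False by (intro gauge_pair_update \<epsilon> i) simp
        have "A $ ?p $ q * T ?z =
            gauge \<epsilon> m x * gauge \<epsilon> m ?z * ?a' * (gauge \<epsilon> m ?z * gauge \<epsilon> m y * T' (map \<rho> ?z))"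
          unfolding a IH s ..
        also have "\<dots> = gauge \<epsilon> m x * gauge \<epsilon> m y *
            ((gauge \<epsilon> m ?z * gauge \<epsilon> m ?z) * (?a' * T' (map \<rho> ?z)))"
          by (simp only: mult_ac)
        finally show ?thesis by (simp only: gauge_square[OF \<epsilon>] mult_1)
      next
        case True
        then show ?thesis unfolding a by simp
      qed
    next
      case False
      \<comment> \<open>Here the letter lowers the degree strictly, so the rest of the word would
        have to lead from \<open>y\<close> to the list \<open>?z\<close> of larger degree.\<close>
      have "A $ ?p $ q * T ?z = 0"
      proof (rule ccontr)
        assume nz: "A $ ?p $ q * T ?z \<noteq> 0"
        then have "word_op (letter_word M N \<beta>) (pure_tensor y) ?z \<noteq> 0" by (auto simp: T_def)
        then have "sum_list (map \<phi> ?z) \<le> sum_list (map \<phi> y)"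
          by (rule word_op_mono[OF mono z])
        moreover have "A $ ?p $ q \<noteq> 0" using nz by auto
        then have "\<phi> (x ! (i - 1)) + \<phi> (x ! i) < \<phi> (fst q) + \<phi> (snd q)"
          using graded_partD(1)[OF A, of ?p q] False by simp
        ultimately show False using sum_z Cons.prems by linarith
      qed
      moreover have "?a' = 0"
        using graded_partD(2)[OF A, of ?p q] False by auto
      ultimately show ?thesis by simp
    qed
  qed
  have "word_op (letter_word M N (a # \<beta>)) (pure_tensor y) x = act_at i A T x"
    by (simp add: letter_word_def T_def i_def A_def)
  also have "\<dots> = gauge \<epsilon> m x * gauge \<epsilon> m y * (\<Sum>q\<in>UNIV.
      A' $ (\<rho> (x ! (i - 1)), \<rho> (x ! i)) $ (\<rho> (fst q), \<rho> (snd q)) *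
        T' (map \<rho> (x[i - 1 := fst q, i := snd q])))"
    unfolding act_at_eq termwise by (simp add: sum_distrib_left)
  also have "(\<Sum>q\<in>UNIV. A' $ (\<rho> (x ! (i - 1)), \<rho> (x ! i)) $ (\<rho> (fst q), \<rho> (snd q)) *
        T' (map \<rho> (x[i - 1 := fst q, i := snd q]))) = act_at i A' T' (map \<rho> x)"
    using sum.reindex_bij_betw[of "map_prod \<rho> \<rho>" UNIV UNIV
        "\<lambda>q. A' $ (map \<rho> x ! (i - 1), map \<rho> x ! i) $ q * T' ((map \<rho> x)[i - 1 := fst q, i := snd q])"] i \<rho>
    by (simp add: act_at_eq map_update bij_def prod.inj_map map_prod_surj)
      (simp add: map_prod_def case_prod_unfold)
  also have "\<dots> = word_op (letter_word M' N' (a # \<beta>)) (pure_tensor (map \<rho> y)) (map \<rho> x)"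
    by (simp add: letter_word_def T'_def i_def A'_def)
  finally show ?case .
qed

text \<open>On two nontransparent vectors this is minus the identity rather than minus the flip: it
  is what remains of -1 + \<open>hecke_sym\<close> when \<open>hecke_sym\<close> is dropped.\<close>

definition super_flip :: "('a::comm_ring_1)^(3 \<times> 3)^(3 \<times> 3)" where
  "super_flip = (\<chi> p q.
     if fst p \<noteq> 0 \<and> snd p \<noteq> 0 then (if p = q then -1 else 0) else if q = (snd p, fst p) then 1 else 0)"

text \<open>Call this S. It is \<open>w\<close> times the projection of the tensor square of the
  span of v_1 and v_2 to its q-symmetric part, with basis v_1 \<otimes> v_1, v_1 \<otimes> v_2 + w^2
  v_2 \<otimes> v_1, v_2 \<otimes> v_2. Thus S^2 = w S when w^2 = w - 1.\<close>

definition hecke_sym :: "'a \<Rightarrow> ('a::comm_ring_1)^(3 \<times> 3)^(3 \<times> 3)" where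
  "hecke_sym w = (\<chi> p q.
     if p = q \<and> p \<in> {(1, 1), (2, 2)} then w
     else if p = (1, 2) \<and> q = (1, 2) then w^2
     else if p = (2, 1) \<and> q = (2, 1) then 1
     else if p = (1, 2) \<and> q = (2, 1) \<or> p = (2, 1) \<and> q = (1, 2) then - w
     else 0)"

text \<open>The value c = 1 gives the graded R-matrix and c = -w its inverse, since (-1 + S)(-1 - w
  S) = 1 for S = \<open>hecke_sym\<close> with S^2 = w S and w^2 = w - 1. With c = 0 only the signed
  flip is left.\<close>

definition graded_R :: "'a::comm_ring_1 \<Rightarrow> 'a \<Rightarrow> 'a^(3 \<times> 3)^(3 \<times> 3)" where
  "graded_R w c = (\<chi> p q. super_flip $ p $ q + c * hecke_sym w $ p $ q)"

text \<open>At t = 1 the entry t - u from v_1 \<otimes> v_1 to v_0 \<otimes> v_2 vanishes, so no v_0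
  is created. The entry w t + u, which destroys one, survives but has no degree-preserving
  part.\<close>

lemma graded_part_ado_one:
  assumes ww: "w * w = w - (1::'a::comm_ring_1)"
  defines "\<phi> \<equiv> \<lambda>a::3. of_bool (a = 0) :: int"
  shows "graded_part \<phi> id 2 1 (ado_R w 1 1) (graded_R w 1)"
    and "graded_part \<phi> id 2 1 (ado_R_inv w 1 1) (graded_R w (- w))"
proof -
  note simps = graded_R_def super_flip_def hecke_sym_def \<phi>_def power2_eq_square ww sixth_root_mult[OF ww] algebra_simps
  show "graded_part \<phi> id 2 1 (ado_R w 1 1) (graded_R w 1)"
    unfolding graded_part_def all_pairs_3
    by (simp add: simps ado_R_def ado_R_image_def axis_def Let_def)
  show "graded_part \<phi> id 2 1 (ado_R_inv w 1 1) (graded_R w (- w))"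
    unfolding graded_part_def all_pairs_3
    by (simp add: simps ado_R_inv_def)
qed

text \<open>At t = w the roles are exchanged: w t + u = w^2 + 1 - w = 0, whereas t - u survives and
  creates a v_2, so the degree counts the other vectors. The shift of indices modulo 3 sends the
  transparent index 2 to 0, and the gauge at v_1 removes the signs picked up when v_1 passes v_0 or
  v_2.\<close>

lemma graded_part_ado_omega:
  assumes ww: "w * w = w - (1::'a::comm_ring_1)"
  defines "\<phi> \<equiv> \<lambda>a::3. of_bool (a \<noteq> 2) :: int"
  shows "graded_part \<phi> (\<lambda>a. a + 1) 1 (-1) (ado_R w w (1 - w)) (graded_R w 1)"
    and "graded_part \<phi> (\<lambda>a. a + 1) 1 (-1) (ado_R_inv w w (1 - w)) (graded_R w (- w))"
proof -
  note simps = graded_R_def super_flip_def hecke_sym_def \<phi>_def power2_eq_square ww sixth_root_mult[OF ww] algebra_simps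
  show "graded_part \<phi> (\<lambda>a. a + 1) 1 (-1) (ado_R w w (1 - w)) (graded_R w 1)"
    unfolding graded_part_def all_pairs_3
    by (simp add: simps ado_R_def ado_R_image_def axis_def Let_def)
  show "graded_part \<phi> (\<lambda>a. a + 1) 1 (-1) (ado_R_inv w w (1 - w)) (graded_R w (- w))"
    unfolding graded_part_def all_pairs_3
    by (simp add: simps ado_R_inv_def)
qed

lemma sum_word_op_graded:
  fixes M M' N N' :: "'a::comm_ring_1^('d::finite \<times> 'd)^('d \<times> 'd)"
  assumes M: "graded_part \<phi> \<rho> m \<epsilon> M M'" and N: "graded_part \<phi> \<rho> m \<epsilon> N N'"
    and \<epsilon>: "\<epsilon> * \<epsilon> = 1" and \<rho>: "bij \<rho>" and \<beta>: "braid_word n \<beta>" and n: "1 \<le> n"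
  shows "(\<Sum>a | length a = n - 1. prod_list (map (d \<circ> \<rho>) a) *
      word_op (letter_word M N \<beta>) (pure_tensor (s # a)) (s # a)) =
    (\<Sum>a | length a = n - 1. prod_list (map d a) *
      word_op (letter_word M' N' \<beta>) (pure_tensor (\<rho> s # a)) (\<rho> s # a))"
proof (rule sum.reindex_bij_witness[where i = "map (inv \<rho>)" and j = "map \<rho>"])
  fix a :: "'d list" assume "a \<in> {a. length a = n - 1}"
  then show "prod_list (map d (map \<rho> a)) *
      word_op (letter_word M' N' \<beta>) (pure_tensor (\<rho> s # map \<rho> a)) (\<rho> s # map \<rho> a) =
    prod_list (map (d \<circ> \<rho>) a) * word_op (letter_word M N \<beta>) (pure_tensor (s # a)) (s # a)"
    using word_op_graded[OF M N \<epsilon> \<rho> \<beta>, of "s # a" "s # a"] n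
    by (simp add: gauge_square[OF \<epsilon>] o_def)
qed (use \<rho> in \<open>simp_all add: o_def bij_is_inj surj_f_inv_f[OF bij_is_surj] map_idI\<close>)

definition graded_trace :: "nat \<Rightarrow> artin list \<Rightarrow> complex" where
  "graded_trace n \<beta> = (\<Sum>a | length a = n - 1. prod_list (map (ado_d omega 1) a) *
    word_op (letter_word (graded_R omega 1) (graded_R omega (- omega)) \<beta>)
      (pure_tensor (0 # a)) (0 # a))"

lemma laurent_eval_ADO3_one:
  assumes "2 \<le> n" "braid_word n \<beta>"
  shows "laurent_eval (ADO3 n \<beta>) 1 = graded_trace n \<beta>"
  using sum_word_op_graded[OF graded_part_ado_one[OF omega_square] _ bij_id assms(2), of "ado_d omega 1" 0] assms(1)
  by (simp add: laurent_eval_ADO3[OF assms, of 1 0] graded_trace_def ado_word_def)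

lemma laurent_eval_ADO3_omega:
  assumes "2 \<le> n" "braid_word n \<beta>"
  shows "laurent_eval (ADO3 n \<beta>) omega = graded_trace n \<beta>"
proof -
  have "omega * (1 - omega) = 1"
    by (simp add: right_diff_distrib omega_square)
  then have inv: "1 / omega = 1 - omega"
    using omega_nonzero by (simp add: field_simps)
  \<comment> \<open>The weight t^2 \<omega>^(2i) at t = \<omega> is \<omega>^(2(i+1)), and
    \<omega>^6 = 1 makes the shift cyclic.\<close>
  have d: "ado_d omega omega = ado_d omega 1 \<circ> (\<lambda>a. a + 1)"
  proof -
    have "\<forall>a. ado_d omega omega a = ado_d omega 1 (a + 1)"
      unfolding all_3
      by (simp add: ado_d_def power2_eq_square power4_eq_xxxx omega_square algebra_simps)
    then show ?thesis by (simp add: fun_eq_iff)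
  qed
  have "bij (\<lambda>a::3. a + 1)"
    by (rule bij_plus_right)
  from sum_word_op_graded[OF graded_part_ado_omega[OF omega_square] _ this assms(2), of "ado_d omega 1" 2]
  show ?thesis
    using assms(1)
    by (simp add: laurent_eval_ADO3[OF assms omega_nonzero, of 2] graded_trace_def ado_word_def inv d three_eq_zero)
qed

section \<open>Replacing the graded R-matrix by signed flips\<close>

text \<open>The lowering operator for a trivial summand spanned by v_0 and a two-dimensional one
  spanned by v_1 and v_2.\<close>

definition graded_e :: "('a::comm_ring_1)^3^3" where
  "graded_e = (\<chi> a c. if a = 2 \<and> c = 1 then 1 else 0)"

lemma graded_e_nth: "graded_e $ a $ c = (if a = 2 \<and> c = 1 then 1 else 0)"
  by (simp add: graded_e_def)

lemma graded_R_zero: "graded_R w 0 = super_flip"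
  by (simp add: graded_R_def vec_eq_iff)

lemma super_flip_row:
  "(\<Sum>q\<in>UNIV. super_flip $ (a, b) $ q * f q) = (if a \<noteq> 0 \<and> b \<noteq> 0 then - f (a, b) else f (b, a))"
proof -
  have "\<forall>a b. (\<Sum>q\<in>UNIV. super_flip $ (a, b) $ q * f q) = (if a \<noteq> 0 \<and> b \<noteq> 0 then - f (a, b) else f (b, a))"
    unfolding all_3 by (simp add: sum_pairs_3 super_flip_def)
  then show ?thesis by blast
qed

context
  fixes w :: "'a::comm_ring_1" and n :: nat
  assumes ww: "w * w = w - 1" and n: "2 \<le> n"
begin

private abbreviation "k \<equiv> ado_k w 1"
private abbreviation "C \<equiv> coproduct graded_e (ado_k w 1)"

private lemmas entries = hecke_sym_def super_flip_def graded_R_def ado_k_def coproduct_nth graded_e_def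
private lemma w_power: "w ^ 6 = 1" "w ^ 8 = w - 1"
proof -
  have "w ^ 3 = -1" by (simp add: power3_eq_cube ww sixth_root_mult[OF ww] algebra_simps)
  then have "(w ^ 3) ^ 2 = 1" by simp
  then show 6: "w ^ 6 = 1" by (simp flip: power_mult)
  have "w ^ 8 = w ^ 6 * (w * w)" by (simp add: eval_nat_numeral)
  then show "w ^ 8 = w - 1" by (simp add: 6 ww)
qed

private lemmas ring = power2_eq_square power4_eq_xxxx w_power ww sixth_root_mult[OF ww] algebra_simps

lemma super_flip_commute: "super_flip ** C = C ** super_flip"
  unfolding vec_eq_iff all_pairs_3 matrix_matrix_mult_def
  by (simp add: sum_pairs_3 entries)

lemma hecke_sym_commute: "hecke_sym w ** C = C ** hecke_sym w"
  unfolding vec_eq_iff all_pairs_3 matrix_matrix_mult_def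
  by (simp add: sum_pairs_3 entries) (simp add: ring)

lemma graded_R_commute: "graded_R w c ** C = C ** graded_R w c"
proof -
  have "graded_R w c ** C = super_flip ** C + (\<chi> p q. c * (hecke_sym w ** C) $ p $ q)"
    by (simp add: graded_R_def matrix_matrix_mult_def vec_eq_iff distrib_right sum.distrib
        sum_distrib_left mult.assoc)
  moreover have "C ** graded_R w c = C ** super_flip + (\<chi> p q. c * (C ** hecke_sym w) $ p $ q)"
    by (simp add: graded_R_def matrix_matrix_mult_def vec_eq_iff distrib_left sum.distrib
        sum_distrib_left mult_ac)
  ultimately show ?thesis by (simp add: super_flip_commute hecke_sym_commute)
qed

lemma graded_R_k:
  assumes "graded_R w c $ p $ q \<noteq> 0"
  shows "k (fst p) * k (snd p) = k (fst q) * k (snd q)"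
proof -
  have "\<forall>p q. graded_R w c $ p $ q = 0 \<or> k (fst p) * k (snd p) = k (fst q) * k (snd q)"
    unfolding all_pairs_3 by (simp add: entries)
  then show ?thesis using assms by blast
qed

lemma graded_R_inverse:
  "graded_R w 1 ** graded_R w (- w) = mat 1" "graded_R w (- w) ** graded_R w 1 = mat 1"
  unfolding vec_eq_iff all_pairs_3 matrix_matrix_mult_def
  by (simp_all add: sum_pairs_3 entries mat_def) (simp_all add: ring)

text \<open>
  On the span of the basis vectors 1 and 2 the image of \<open>hecke_sym\<close> is the three-dimensional
  summand, which has quantum dimension \<open>0\<close>. This makes it a commutator.
\<close>

lemma hecke_sym_commutator:
  defines "Y \<equiv> \<chi> p q.
    if p = (1, 2) \<and> q = (2, 2) then 1 else if p = (2, 1) \<and> q = (2, 2) then w^2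
    else if p = (1, 1) \<and> q = (1, 2) then -1 else if p = (1, 1) \<and> q = (2, 1) then - (w^2) else 0"
  shows "C ** Y - Y ** C = (\<chi> p q. hecke_sym w $ p $ q * (k (fst q) * k (snd q)))"
  unfolding vec_eq_iff all_pairs_3 matrix_matrix_mult_def
  by (simp add: sum_pairs_3 entries Y_def) (simp add: ring)

lemma hecke_sym_row:
  "(\<Sum>q\<in>UNIV. hecke_sym w $ (0, b) $ q * f q) = 0"
  "(\<Sum>q\<in>UNIV. hecke_sym w $ (a, 0) $ q * f q) = 0"
  "(\<Sum>q\<in>UNIV. hecke_sym w $ (1, 1) $ q * f q) = w * f (1, 1)"
  "(\<Sum>q\<in>UNIV. hecke_sym w $ (1, 2) $ q * f q) = (w - 1) * f (1, 2) - w * f (2, 1)"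
  "(\<Sum>q\<in>UNIV. hecke_sym w $ (2, 1) $ q * f q) = f (2, 1) - w * f (1, 2)"
  "(\<Sum>q\<in>UNIV. hecke_sym w $ (2, 2) $ q * f q) = w * f (2, 2)"
  by (simp_all add: sum_pairs_3 entries ring)

lemma graded_R_row:
  "(\<Sum>q\<in>UNIV. graded_R w c $ p $ q * f q) =
    (\<Sum>q\<in>UNIV. super_flip $ p $ q * f q) + c * (\<Sum>q\<in>UNIV. hecke_sym w $ p $ q * f q)"
  by (simp add: graded_R_def distrib_right sum.distrib sum_distrib_left mult.assoc)

text \<open>Written as nested row sums over three neighbouring factors, so that the row formulas
  turn it into 27 scalar identities.\<close>

lemma hecke_sym_braid_triple:
  "(\<Sum>q\<in>UNIV. hecke_sym w $ (b, c) $ q * (\<Sum>r\<in>UNIV. graded_R w 1 $ (a, fst q) $ r *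
      (\<Sum>s\<in>UNIV. graded_R w 1 $ (snd r, snd q) $ s * f (fst r) (fst s) (snd s)))) =
   (\<Sum>q\<in>UNIV. graded_R w 1 $ (a, b) $ q * (\<Sum>r\<in>UNIV. graded_R w 1 $ (snd q, c) $ r *
      (\<Sum>s\<in>UNIV. hecke_sym w $ (fst q, fst r) $ s * f (fst s) (snd s) (snd r))))"
proof -
  have "\<forall>a b c. (\<Sum>q\<in>UNIV. hecke_sym w $ (b, c) $ q * (\<Sum>r\<in>UNIV. graded_R w 1 $ (a, fst q) $ r *
      (\<Sum>s\<in>UNIV. graded_R w 1 $ (snd r, snd q) $ s * f (fst r) (fst s) (snd s)))) =
   (\<Sum>q\<in>UNIV. graded_R w 1 $ (a, b) $ q * (\<Sum>r\<in>UNIV. graded_R w 1 $ (snd q, c) $ r *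
      (\<Sum>s\<in>UNIV. hecke_sym w $ (fst q, fst r) $ s * f (fst s) (snd s) (snd r))))"
    unfolding all_3 by (simp add: graded_R_row hecke_sym_row super_flip_row) (simp add: ring)
  then show ?thesis by blast
qed

text \<open>The braid relation with one R replaced by \<open>hecke_sym\<close>. It shows that the
  insertions at two neighbouring places are conjugate.\<close>

lemma hecke_sym_braid:
  assumes "1 \<le> i" "Suc i < length x"
  shows "act_at (Suc i) (hecke_sym w) (act_at i (graded_R w 1) (act_at (Suc i) (graded_R w 1) f)) x =
    act_at i (graded_R w 1) (act_at (Suc i) (graded_R w 1) (act_at i (hecke_sym w) f)) x"
  using assms
proof (induction i arbitrary: x f)
  case (Suc i)
  show ?case
  proof (cases "i = 0")
    case True
    have "Suc (Suc (Suc 0)) \<le> length x" using Suc.prems by simp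
    then obtain a b c y where x: "x = a # b # c # y"
      by (auto simp: Suc_le_length_iff)
    have *: "act_at (Suc (Suc 0)) M f (a # b # c # y) = (\<Sum>q\<in>UNIV. M $ (b, c) $ q * f (a # fst q # snd q # y))"
      for M and f :: "('a, 3) tensor" and a b c y
      by (simp add: act_at_eq)
    show ?thesis
      using hecke_sym_braid_triple[where f = "\<lambda>a b c. f (a # b # c # y)"]
      by (simp add: True x * act_at_first)
  next
    case False
    obtain a y where x: "x = a # y" using Suc.prems by (cases x) auto
    show ?thesis
      using Suc.IH[of y "\<lambda>y. f (a # y)"] Suc.prems False by (simp add: x act_at_Suc)
  qed
qed simp

private abbreviation "H \<equiv> scale (\<lambda>x. prod_list (map (ado_k w 1) x)) :: ('a, 3) tensor \<Rightarrow> ('a, 3) tensor"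

text \<open>Intertwiners of the quantum group action: they commute with the lowering operator and
  with the group-like element \<open>H\<close>. The latter is what allows cyclic rotation in a trace
  weighted by \<open>H\<close>.\<close>

definition invariant_op :: "(('a, 3) tensor \<Rightarrow> ('a, 3) tensor) \<Rightarrow> bool" where
  "invariant_op X \<longleftrightarrow> linear_on n X \<and> commute_on n X (ladder graded_e k) \<and> commute_on n X H"

lemma invariant_op_comp: "invariant_op X \<Longrightarrow> invariant_op Y \<Longrightarrow> invariant_op (X \<circ> Y)"
  by (simp add: invariant_op_def linear_on_comp commute_on_comp)

lemma invariant_op_id: "invariant_op id"
  unfolding invariant_op_def by (intro conjI linear_on_id commute_on_id)

lemma invariant_op_graded_R:
  assumes "1 \<le> i" "i < n"
  shows "invariant_op (act_at i (graded_R w c))"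
  unfolding invariant_op_def
proof (intro conjI)
  show "commute_on n (act_at i (graded_R w c)) (ladder graded_e k)"
    using assms by (auto simp: commute_on_def intro!: act_at_ladder graded_R_commute graded_R_k)
  show "commute_on n (act_at i (graded_R w c)) H"
    unfolding commute_on_def
  proof (intro allI impI)
    fix f and x :: "3 list" assume x: "length x = n"
    with assms have i: "1 \<le> i" "i < length x" by auto
    have "graded_R w c $ (x ! (i - 1), x ! i) $ q * (prod_list (map k (x[i - 1 := fst q, i := snd q])) * z) =
        prod_list (map k x) * (graded_R w c $ (x ! (i - 1), x ! i) $ q * z)" for q z
      using graded_R_k[of c "(x ! (i - 1), x ! i)" q]
      by (cases "graded_R w c $ (x ! (i - 1), x ! i) $ q = 0")
        (simp_all only: prod_list_pair[OF i] prod_list_pair_update[OF i] fst_conv snd_conv mult_ac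
          mult_zero_left mult_zero_right simp_thms)
    then show "act_at i (graded_R w c) (H f) x = H (act_at i (graded_R w c) f) x"
      by (simp add: act_at_eq scale_def sum_distrib_left)
  qed
qed (use assms in \<open>simp add: linear_on_act_at\<close>)

text \<open>A quantum trace through a summand of quantum dimension 0 vanishes. At the first two
  factors the insertion is a commutator; any other place is moved down by conjugation, which alters
  the intertwiner \<open>X\<close> and requires it to be arbitrary in the induction.\<close>

lemma op_trace_hecke_sym:
  assumes "1 \<le> i" "i < n" "invariant_op X"
  shows "op_trace n (act_at i (hecke_sym w) \<circ> H \<circ> X) = 0"
  using assms
proof (induction i arbitrary: X)
  case (Suc i)
  let ?D = "\<lambda>i. act_at i (hecke_sym w) :: ('a, 3) tensor \<Rightarrow> ('a, 3) tensor"
  show ?case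
  proof (cases "i = 0")
    case True
    \<comment> \<open>\<open>C\<close> descends from v_1 \<otimes> v_1 through s = v_1 \<otimes> v_2
      + w^2 v_2 \<otimes> v_1 to v_2 \<otimes> v_2, up to scalars. \<open>Y\<close> climbs back: it
      sends v_2 \<otimes> v_2 to s and s to w^2 v_1 \<otimes> v_1, and it kills v_1 \<otimes> v_1
      and the complementary vector v_1 \<otimes> v_2 + w v_2 \<otimes> v_1.\<close>
    define Y :: "'a^(3 \<times> 3)^(3 \<times> 3)" where "Y = (\<chi> p q.
      if p = (1, 2) \<and> q = (2, 2) then 1 else if p = (2, 1) \<and> q = (2, 2) then w^2
      else if p = (1, 1) \<and> q = (1, 2) then -1 else if p = (1, 1) \<and> q = (2, 1) then - (w^2) else 0)"
    have "op_trace n (?D 1 \<circ> H \<circ> X) =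
      op_trace n (act_at 1 (C ** Y - Y ** C) \<circ> scale (\<lambda>x. prod_list (map k (drop 2 x))) \<circ> X)"
    proof (rule op_trace_cong)
      fix f and x :: "3 list" assume "length x = n"
      then have "Suc (Suc 0) \<le> length x" using n by simp
      then obtain a b y where x: "x = a # b # y"
        by (auto simp: Suc_le_length_iff)
      show "(?D 1 \<circ> H \<circ> X) f x =
        (act_at 1 (C ** Y - Y ** C) \<circ> scale (\<lambda>x. prod_list (map k (drop 2 x))) \<circ> X) f x"
        unfolding Y_def hecke_sym_commutator
        by (simp add: x act_at_first scale_def mult_ac)
    qed
    \<comment> \<open>Here the weight is \<open>k\<close> itself, so the quotient g = h k^(-1) is
      1.\<close>
    also have "\<dots> = 0"
      using Suc.prems n by (intro op_trace_commutator[where g = "\<lambda>_. 1"]) (auto simp: invariant_op_def)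
    finally show ?thesis by (simp only: True One_nat_def)
  next
    case False
    let ?R = "\<lambda>i. act_at i (graded_R w 1) :: ('a, 3) tensor \<Rightarrow> ('a, 3) tensor"
    let ?S = "\<lambda>i. act_at i (graded_R w (- w)) :: ('a, 3) tensor \<Rightarrow> ('a, 3) tensor"
    \<comment> \<open>Conjugation by \<open>P\<close>, with inverse \<open>P'\<close>, carries the
      insertion at \<open>i\<close> to the one at \<open>Suc i\<close>.\<close>
    define P P' where "P = ?R i \<circ> ?R (Suc i)" and "P' = ?S (Suc i) \<circ> ?S i"
    have i: "1 \<le> i" "i < n" "1 \<le> Suc i" "Suc i < n" using False Suc.prems by auto
    have P: "invariant_op P" "invariant_op P'"
      unfolding P_def P'_def using i by (auto intro!: invariant_op_comp invariant_op_graded_R)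
    have lin: "linear_on n (?D i)" "linear_on n (?D (Suc i))" "linear_on n H" "linear_on n X"
        "linear_on n P" "linear_on n P'"
      using i P Suc.prems by (auto simp: linear_on_act_at linear_on_scale invariant_op_def)
    have RS: "?R j (?S j f) x = f x" if "length x = n" "j = i \<or> j = Suc i" for j f x
    proof -
      have "act_at j (mat 1) f x = f x"
        using that i by (auto simp: act_at_eq mat_def if_distrib[of "\<lambda>z. z * _"] cong: if_cong)
      then show ?thesis
        using act_at_mult[of j x "graded_R w 1" "graded_R w (- w)" f] that i by (auto simp: graded_R_inverse)
    qed
    have PP': "P (P' f) x = f x" if "length x = n" for f x
    proof -
      have "P (P' f) x = ?R i (?S i f) x"
        unfolding P_def P'_def comp_apply
        using RS i that by (intro linear_on_cong[OF linear_on_act_at]) auto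
      then show ?thesis using RS that by simp
    qed
    have "?D (Suc i) f x = P (?D i (P' f)) x" if x: "length x = n" for f x
    proof -
      have "?D (Suc i) f x = ?D (Suc i) (P (P' f)) x"
        using PP' by (intro linear_on_cong[OF lin(2) x]) simp
      also have "\<dots> = P (?D i (P' f)) x"
        unfolding P_def comp_apply using i x by (intro hecke_sym_braid) auto
      finally show ?thesis .
    qed
    then have "op_trace n (?D (Suc i) \<circ> H \<circ> X) = op_trace n (P \<circ> (?D i \<circ> P' \<circ> H \<circ> X))"
      by (intro op_trace_cong) simp
    also have "\<dots> = op_trace n ((?D i \<circ> P' \<circ> H \<circ> X) \<circ> P)"
      by (intro op_trace_commute linear_on_comp lin)
    also have "\<dots> = op_trace n (?D i \<circ> H \<circ> (P' \<circ> X \<circ> P))"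
    proof (rule op_trace_cong)
      fix f and x :: "3 list" assume "length x = n"
      then show "((?D i \<circ> P' \<circ> H \<circ> X) \<circ> P) f x = (?D i \<circ> H \<circ> (P' \<circ> X \<circ> P)) f x"
        unfolding comp_apply using P(2)
        by (intro linear_on_cong[OF lin(1)]) (auto simp: invariant_op_def commute_on_def)
    qed
    also have "\<dots> = 0"
      using Suc.IH i P Suc.prems by (auto intro!: invariant_op_comp simp del: o_apply)
    finally show ?thesis .
  qed
qed simp

text \<open>The letters are replaced from the left, and \<open>X\<close> collects those already
  replaced; they are intertwiners because \<open>super_flip\<close> is \<open>graded_R w 0\<close>.
  A separate coefficient for each letter covers both crossings.\<close>

lemma op_trace_super_flip:
  assumes "invariant_op X" "\<forall>(i, c)\<in>set cs. 1 \<le> i \<and> i < n"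
  shows "op_trace n (H \<circ> X \<circ> word_op (map (\<lambda>(i, c). (i, graded_R w c)) cs)) =
    op_trace n (H \<circ> X \<circ> word_op (map (\<lambda>(i, c). (i, super_flip)) cs))"
  using assms
proof (induction cs arbitrary: X)
  case (Cons ic cs)
  obtain i c where ic: "ic = (i, c)" by fastforce
  have i: "1 \<le> i" "i < n" using Cons.prems by (auto simp: ic)
  let ?D = "act_at i (hecke_sym w) :: ('a, 3) tensor \<Rightarrow> ('a, 3) tensor"
  let ?Q = "act_at i super_flip :: ('a, 3) tensor \<Rightarrow> ('a, 3) tensor"
  define W where "W = word_op (map (\<lambda>(i, c). (i, graded_R w c)) cs)"
  have W: "invariant_op W"
    unfolding W_def using Cons.prems(2)
  proof (induction cs)
    case Nil
    then show ?case by (simp only: list.map word_op.simps invariant_op_id)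
  next
    case (Cons a cs)
    then show ?case by (cases a) (auto intro!: invariant_op_comp invariant_op_graded_R simp del: o_apply)
  qed
  have lin: "linear_on n H" "linear_on n X" "linear_on n W" "linear_on n ?D"
    using i W Cons.prems by (auto simp: linear_on_act_at linear_on_scale invariant_op_def)
  have XW: "linear_on n (H \<circ> X)" by (intro linear_on_comp lin)
  have split: "(H \<circ> X \<circ> word_op (map (\<lambda>(i, c). (i, graded_R w c)) (ic # cs))) f x =
      (H \<circ> (X \<circ> ?Q) \<circ> W) f x + c * (H \<circ> X \<circ> (?D \<circ> W)) f x" if x: "length x = n" for f x
  proof -
    have "act_at i (graded_R w c) g y = ?Q g y + c * ?D g y" for g y
      by (simp add: act_at_eq graded_R_row)
    then have "(H \<circ> X) (act_at i (graded_R w c) g) x = (H \<circ> X) (?Q g) x + c * (H \<circ> X) (?D g) x" for g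
      unfolding linear_onD[OF XW x, of "act_at i (graded_R w c) g"] linear_onD[OF XW x, of "?Q g"]
        linear_onD[OF XW x, of "?D g"]
      by (simp add: distrib_left sum.distrib sum_distrib_left mult_ac)
    then show ?thesis by (simp add: ic W_def)
  qed
  \<comment> \<open>Cyclicity brings the insertion to the front. Moving \<open>H\<close> past the
    intertwiner \<open>W\<close> then restores the form of the vanishing trace.\<close>
  have "op_trace n (H \<circ> X \<circ> (?D \<circ> W)) = op_trace n (?D \<circ> W \<circ> (H \<circ> X))"
    by (intro op_trace_commute linear_on_comp lin)
  also have "\<dots> = op_trace n (?D \<circ> H \<circ> (W \<circ> X))"
  proof (rule op_trace_cong)
    fix f and x :: "3 list" assume "length x = n"
    then show "(?D \<circ> W \<circ> (H \<circ> X)) f x = (?D \<circ> H \<circ> (W \<circ> X)) f x"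
      unfolding comp_apply using W
      by (intro linear_on_cong[OF lin(4)]) (auto simp: invariant_op_def commute_on_def)
  qed
  also have "\<dots> = 0"
    using i W Cons.prems by (intro op_trace_hecke_sym invariant_op_comp) auto
  finally have D: "op_trace n (H \<circ> X \<circ> (?D \<circ> W)) = 0" .
  have "op_trace n (H \<circ> X \<circ> word_op (map (\<lambda>(i, c). (i, graded_R w c)) (ic # cs))) =
      (\<Sum>x | length x = n. (H \<circ> (X \<circ> ?Q) \<circ> W) (pure_tensor x) x + c * (H \<circ> X \<circ> (?D \<circ> W)) (pure_tensor x) x)"
    unfolding op_trace_def by (rule sum.cong) (simp_all only: split mem_Collect_eq)
  also have "\<dots> = op_trace n (H \<circ> (X \<circ> ?Q) \<circ> W) + c * op_trace n (H \<circ> X \<circ> (?D \<circ> W))"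
    by (simp only: op_trace_def sum.distrib sum_distrib_left)
  also have "\<dots> = op_trace n (H \<circ> (X \<circ> ?Q) \<circ> word_op (map (\<lambda>(i, c). (i, super_flip)) cs))"
    unfolding W_def D[unfolded W_def]
    using Cons.prems invariant_op_graded_R[OF i, of 0]
    by (subst Cons.IH) (auto simp: graded_R_zero intro!: invariant_op_comp simp del: o_apply)
  finally show ?case by (simp only: ic list.map prod.case word_op.simps o_assoc)
qed simp

text \<open>v_0 spans a trivial summand, so projecting the first factor onto it is an intertwiner.
  Thereby the partial trace becomes a full quantum trace.\<close>

lemma invariant_op_first: "invariant_op (scale (\<lambda>x. if x ! 0 = 0 then 1 else 0))"
proof -
  have "ladder graded_e k (\<lambda>x. (if x ! 0 = 0 then 1 else 0) * f x) x =
      (if x ! 0 = 0 then 1 else 0) * ladder graded_e k f x" if len: "length x = n" for f x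
  proof -
    obtain a y where x: "x = a # y" using len n by (cases x) auto
    have *: "ladder graded_e k (\<lambda>y. c * f (a # y)) y = c * ladder graded_e k (\<lambda>y. f (a # y)) y" for c
      using ladder_sum[of graded_e k "\<lambda>_. c" "\<lambda>_ y. f (a # y)" "{()}" y] by simp
    have "ladder graded_e k (\<lambda>_. 0) y = 0"
      using *[of 0] by simp
    then show ?thesis
      by (auto simp: x sum_3_0 graded_e_nth)
  qed
  then show ?thesis
    by (auto simp: invariant_op_def linear_on_scale commute_on_def scale_def mult_ac)
qed

lemma sum_graded_R_eq_super_flip:
  assumes \<beta>: "braid_word n \<beta>"
  shows "(\<Sum>a | length a = n - 1. prod_list (map k a) *
      word_op (letter_word (graded_R w 1) (graded_R w (- w)) \<beta>) (pure_tensor (0 # a)) (0 # a)) =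
    (\<Sum>a | length a = n - 1. prod_list (map k a) *
      word_op (letter_word super_flip super_flip \<beta>) (pure_tensor (0 # a)) (0 # a))"
proof -
  define cs where "cs = letter_word 1 (- w) \<beta>"
  have trace: "op_trace n (H \<circ> scale (\<lambda>x. if x ! 0 = 0 then 1 else 0) \<circ> A) =
      (\<Sum>a | length a = n - 1. prod_list (map k a) * A (pure_tensor (0 # a)) (0 # a))" for A
  proof -
    have trace: "op_trace n (H \<circ> scale (\<lambda>x. if x ! 0 = 0 then 1 else 0) \<circ> A) =
        op_trace n (scale (\<lambda>x. if x ! 0 = 0 then prod_list (map k x) else 0) \<circ> A)"
      by (intro op_trace_cong) (simp add: scale_def)
    \<comment> \<open>\<open>H\<close> also weights the first factor, but only by k(v_0) = 1 after
      the projection.\<close>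
    then show ?thesis
      using op_trace_first[of n 0 "\<lambda>x. prod_list (map k x)" A] n by (simp add: ado_k_def)
  qed
  have R: "map (\<lambda>(i, c). (i, graded_R w c)) cs = letter_word (graded_R w 1) (graded_R w (- w)) \<beta>"
    by (auto simp: cs_def letter_word_def split: artin.split)
  have Q: "map (\<lambda>(i, c). (i, super_flip)) cs =
      (letter_word super_flip super_flip \<beta> :: (nat \<times> ('a^(3 \<times> 3)^(3 \<times> 3))) list)"
    by (auto simp: cs_def letter_word_def split: artin.split)
  have "\<forall>(i, c)\<in>set cs. 1 \<le> i \<and> i < n"
    using \<beta> by (auto simp: cs_def letter_word_def braid_word_def)
  from op_trace_super_flip[OF invariant_op_first this] show ?thesis
    unfolding trace R Q .
qed

end

section \<open>Colourings of the strands\<close>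

definition swap_at :: "nat \<Rightarrow> 'b list \<Rightarrow> 'b list" where
  "swap_at i x = x[i - 1 := x ! i, i := x ! (i - 1)]"

text \<open>Letters are consumed from the left because a coefficient of a word of operators is
  followed from the output back to the input, and the leftmost letter acts last.\<close>

fun permute_word :: "artin list \<Rightarrow> 'b list \<Rightarrow> 'b list" where
  "permute_word [] x = x"
| "permute_word (a # \<beta>) x = permute_word \<beta> (swap_at (artin_index a) x)"

fun crossing_sign :: "artin list \<Rightarrow> bool list \<Rightarrow> int" where
  "crossing_sign [] b = 1"
| "crossing_sign (a # \<beta>) b =
     (if b ! (artin_index a - 1) \<and> b ! artin_index a then -1 else 1) * crossing_sign \<beta> (swap_at (artin_index a) b)"

lemma length_swap_at [simp]: "length (swap_at i x) = length x"
  by (simp add: swap_at_def)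

lemma braid_word_Cons:
  "braid_word n (a # \<beta>) \<longleftrightarrow> 1 \<le> artin_index a \<and> artin_index a < n \<and> braid_word n \<beta>"
  by (auto simp: braid_word_def)

lemma map_swap_at: "1 \<le> i \<Longrightarrow> i < length x \<Longrightarrow> map f (swap_at i x) = swap_at i (map f x)"
  by (simp add: swap_at_def map_update)

lemma mset_swap_at: "1 \<le> i \<Longrightarrow> i < length x \<Longrightarrow> mset (swap_at i x) = mset x"
  by (simp add: swap_at_def mset_swap)

lemma length_permute_word [simp]: "length (permute_word \<beta> x) = length x"
  by (induction \<beta> arbitrary: x) auto

lemma map_permute_word:
  "braid_word (length x) \<beta> \<Longrightarrow> map f (permute_word \<beta> x) = permute_word \<beta> (map f x)"
  by (induction \<beta> arbitrary: x) (auto simp: braid_word_Cons map_swap_at)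

lemma mset_permute_word: "braid_word (length x) \<beta> \<Longrightarrow> mset (permute_word \<beta> x) = mset x"
  by (induction \<beta> arbitrary: x) (auto simp: braid_word_Cons mset_swap_at)

lemma act_at_super_flip:
  "act_at i super_flip f x = (if x ! (i - 1) \<noteq> 0 \<and> x ! i \<noteq> 0 then - f x else f (swap_at i x))"
  by (simp add: act_at_eq super_flip_row swap_at_def)

lemma filter_swap_at:
  assumes i: "1 \<le> i" "i < length x" and P: "\<not> (P (x ! (i - 1)) \<and> P (x ! i))"
  shows "filter P (swap_at i x) = filter P x"
  using P by (subst (2) list_pair_split[OF i]) (auto simp only: swap_at_def list_pair_update[OF i] filter_append filter.simps split: if_splits)

lemma swap_at_same:
  assumes "1 \<le> i" "i < length x" "x ! (i - 1) = x ! i"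
  shows "swap_at i x = x"
  using assms by (simp add: swap_at_def) (metis list_update_id)

lemma filter_map_eq_iff:
  "filter P x = filter P y \<and> map P x = map P y \<longleftrightarrow> x = y"
  if "\<And>a b. \<not> P a \<Longrightarrow> \<not> P b \<Longrightarrow> a = b" for P :: "'b \<Rightarrow> bool"
proof
  show "filter P x = filter P y \<and> map P x = map P y \<Longrightarrow> x = y"
  proof (induction x arbitrary: y)
    case (Cons a x)
    then show ?case using that by (cases y) (auto split: if_splits)
  qed simp
qed simp

text \<open>
  The flips keep the order of the nonzero entries, and only the positions of these entries
  matter.
\<close>

lemma word_op_super_flip:
  assumes "braid_word n \<beta>" "length x = n"
  shows "word_op (letter_word super_flip super_flip \<beta>) (pure_tensor y) x =
    (if filter (\<lambda>a. a \<noteq> 0) x = filter (\<lambda>a. a \<noteq> 0) y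
        \<and> permute_word \<beta> (map (\<lambda>a. a \<noteq> 0) x) = map (\<lambda>a. a \<noteq> 0) y
     then of_int (crossing_sign \<beta> (map (\<lambda>a. a \<noteq> 0) x)) else (0 :: 'a::comm_ring_1))"
  using assms
proof (induction \<beta> arbitrary: x)
  case Nil
  then show ?case
    using filter_map_eq_iff[of "\<lambda>a. a \<noteq> 0" x y] by (auto simp: letter_word_def pure_tensor_def)
next
  case (Cons a \<beta>)
  define i where "i = artin_index a"
  have i: "1 \<le> i" "i < length x" and \<beta>: "braid_word n \<beta>"
    using Cons.prems by (auto simp: i_def braid_word_Cons)
  have step: "word_op (letter_word super_flip super_flip (a # \<beta>)) (pure_tensor y) x =
      act_at i super_flip (word_op (letter_word super_flip super_flip \<beta>) (pure_tensor y :: ('a, 3) tensor)) x"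
    by (cases a) (simp_all add: letter_word_def i_def)
  show ?case
  proof (cases "x ! (i - 1) \<noteq> 0 \<and> x ! i \<noteq> 0")
    case True
    then have "swap_at i (map (\<lambda>a. a \<noteq> 0) x) = map (\<lambda>a. a \<noteq> 0) x"
      using i by (intro swap_at_same) auto
    then show ?thesis
      unfolding step act_at_super_flip Cons.IH[OF \<beta> Cons.prems(2)]
      using True i by (simp flip: i_def)
  next
    case False
    then have filter: "filter (\<lambda>a. a \<noteq> 0) (swap_at i x) = filter (\<lambda>a. a \<noteq> 0) x"
      by (intro filter_swap_at i) simp
    have len: "length (swap_at i x) = n" using Cons.prems by simp
    have act: "act_at i super_flip f x = f (swap_at i x)" for f :: "('a, 3) tensor"
      unfolding act_at_super_flip using False by (simp only: if_False)
    have unsigned: "\<not> (map (\<lambda>a. a \<noteq> 0) x ! (i - 1) \<and> map (\<lambda>a. a \<noteq> 0) x ! i)"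
      using False i by simp
    show ?thesis
      unfolding step act Cons.IH[OF \<beta> len] permute_word.simps crossing_sign.simps
        i_def[symmetric] map_swap_at[OF i] filter if_not_P[OF unsigned] by simp
  qed
qed

lemma sum_lists_Suc:
  fixes f :: "'d::finite list \<Rightarrow> 'a::comm_monoid_add"
  shows "(\<Sum>x | length x = Suc n. f x) = (\<Sum>c\<in>UNIV. \<Sum>x | length x = n. f (c # x))"
proof -
  have "(\<Sum>c\<in>UNIV. \<Sum>x | length x = n. f (c # x)) = (\<Sum>(c, x)\<in>UNIV \<times> {x. length x = n}. f (c # x))"
    by (simp add: sum.cartesian_product)
  also have "\<dots> = (\<Sum>x | length x = Suc n. f x)"
    by (rule sum.reindex_bij_witness[where i = "\<lambda>x. (hd x, tl x)" and j = "\<lambda>(c, x). c # x"])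
      (auto simp: length_Suc_conv)
  finally show ?thesis ..
qed

definition color_weight :: "bool list \<Rightarrow> int" where
  "color_weight b = prod_list (map (\<lambda>c. if c then -1 else 1) b)"

text \<open>The two nonzero labels have the same colour, and their weights w^2 and w^4 add up to
  -1.\<close>

lemma sum_color_weight:
  fixes w :: "'a::comm_ring_1"
  assumes ww: "w * w = w - 1"
  shows "(\<Sum>a | length a = n. prod_list (map (ado_k w 1) a) * G (map (\<lambda>a. a \<noteq> 0) a)) =
    (\<Sum>b | length b = n. of_int (color_weight b) * G b)"
proof (induction n arbitrary: G)
  case 0
  then show ?case by (simp add: color_weight_def)
next
  case (Suc n)
  have k: "ado_k w 1 0 = 1" "ado_k w 1 1 * z + ado_k w 1 2 * z = - z" for z
    by (simp_all add: ado_k_def power2_eq_square power4_eq_xxxx ww sixth_root_mult[OF ww] algebra_simps)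
  let ?S = "\<lambda>c. \<Sum>a | length a = n. prod_list (map (ado_k w 1) a) * G (c # map (\<lambda>a. a \<noteq> 0) a)"
  have "(\<Sum>a | length a = Suc n. prod_list (map (ado_k w 1) a) * G (map (\<lambda>a. a \<noteq> 0) a)) =
      ado_k w 1 0 * ?S False + (ado_k w 1 1 * ?S True + ado_k w 1 2 * ?S True)"
    by (simp add: sum_lists_Suc sum_3_0 sum_distrib_left mult.assoc add.assoc)
  also have "\<dots> = (\<Sum>b | length b = n. of_int (color_weight b) * G (False # b)) -
      (\<Sum>b | length b = n. of_int (color_weight b) * G (True # b))"
    unfolding k Suc.IH[of "\<lambda>b. G (False # b)"] Suc.IH[of "\<lambda>b. G (True # b)"] by simp
  also have "\<dots> = (\<Sum>b | length b = Suc n. of_int (color_weight b) * G b)"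
    by (simp add: sum_lists_Suc UNIV_bool color_weight_def sum_negf)
  finally show ?case .
qed

text \<open>These are the colourings of the components of the closure in which the component of the
  first strand is transparent.\<close>

definition fixed_colorings :: "nat \<Rightarrow> artin list \<Rightarrow> bool list set" where
  "fixed_colorings n \<beta> = {b. length b = n \<and> \<not> b ! 0 \<and> permute_word \<beta> b = b}"

lemma sum_super_flip_eq_sum_colorings:
  fixes w :: "'a::comm_ring_1"
  assumes ww: "w * w = w - 1" and \<beta>: "braid_word n \<beta>" and n: "1 \<le> n"
  shows "(\<Sum>a | length a = n - 1. prod_list (map (ado_k w 1) a) *
      word_op (letter_word super_flip super_flip \<beta>) (pure_tensor (0 # a)) (0 # a)) =
    of_int (\<Sum>b\<in>fixed_colorings n \<beta>. color_weight b * crossing_sign \<beta> b)"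
proof -
  define G where "G b = (if permute_word \<beta> (False # b) = False # b then crossing_sign \<beta> (False # b) else 0)" for b
  have "(\<Sum>a | length a = n - 1. prod_list (map (ado_k w 1) a) *
      word_op (letter_word super_flip super_flip \<beta>) (pure_tensor (0 # a)) (0 # a)) =
    (\<Sum>a | length a = n - 1. prod_list (map (ado_k w 1) a) * of_int (G (map (\<lambda>a. a \<noteq> 0) a)))"
    using n by (intro sum.cong) (auto simp: word_op_super_flip[OF \<beta>] G_def)
  also have "\<dots> = (\<Sum>b | length b = n - 1. of_int (color_weight b * G b))"
    by (simp add: sum_color_weight[OF ww, where G = "\<lambda>b. of_int (G b)"])
  also have "\<dots> = of_int (\<Sum>b | length b = n - 1. color_weight b * G b)"
    by simp
  also have "(\<Sum>b | length b = n - 1. color_weight b * G b) =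
      (\<Sum>b | length b = n - 1 \<and> permute_word \<beta> (False # b) = False # b. color_weight b * G b)"
    by (rule sum.mono_neutral_right) (auto simp: G_def)
  also have "\<dots> = (\<Sum>b\<in>fixed_colorings n \<beta>. color_weight b * crossing_sign \<beta> b)"
    by (rule sum.reindex_bij_witness[where i = tl and j = "\<lambda>b. False # b"])
      (use n in \<open>auto simp: fixed_colorings_def G_def color_weight_def nth_Cons_tl neq_Nil_conv Suc_le_length_iff\<close>)
  finally show ?thesis .
qed

section \<open>Signs as products over pairs of strands\<close>

fun pair_prod :: "('b \<Rightarrow> 'b \<Rightarrow> int) \<Rightarrow> 'b list \<Rightarrow> int" where
  "pair_prod g [] = 1"
| "pair_prod g (x # xs) = prod_list (map (g x) xs) * pair_prod g xs"

lemma pair_prod_append: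
  "pair_prod g (xs @ ys) = pair_prod g xs * pair_prod g ys * prod_list (map (\<lambda>x. prod_list (map (g x) ys)) xs)"
  by (induction xs) (simp_all add: mult_ac)

lemma prod_list_mult:
  fixes f g :: "'b \<Rightarrow> 'a::comm_monoid_mult"
  shows "prod_list (map (\<lambda>x. f x * g x) xs) = prod_list (map f xs) * prod_list (map g xs)"
  by (induction xs) (simp_all add: mult_ac)

text \<open>Only the exchanged pair changes its order; both sides carry its contribution, which
  avoids division.\<close>

lemma pair_prod_swap_at:
  assumes i: "1 \<le> i" "i < length x"
  shows "g (x ! (i - 1)) (x ! i) * pair_prod g (swap_at i x) = g (x ! i) (x ! (i - 1)) * pair_prod g x"
  by (subst (6) list_pair_split[OF i])
    (simp only: swap_at_def list_pair_update[OF i] pair_prod_append pair_prod.simps list.map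
      prod_list.Cons prod_list.Nil map_append prod_list.append prod_list_mult mult_ac)

lemma pair_prod_map: "pair_prod g (map f xs) = pair_prod (\<lambda>x y. g (f x) (f y)) xs"
  by (induction xs) (simp_all add: o_def)

lemma pair_prod_mult: "pair_prod g xs * pair_prod h xs = pair_prod (\<lambda>x y. g x y * h x y) xs"
proof (induction xs)
  case (Cons x xs)
  have "prod_list (map (\<lambda>y. g x y * h x y) xs) = prod_list (map (g x) xs) * prod_list (map (h x) xs)"
    by (induction xs) (simp_all add: mult_ac)
  then show ?case using Cons by (simp add: mult_ac)
qed simp

lemma pair_prod_cong:
  "(\<And>x y. x \<in> set xs \<Longrightarrow> y \<in> set xs \<Longrightarrow> x \<noteq> y \<Longrightarrow> g x y = h x y) \<Longrightarrow> distinct xs \<Longrightarrow>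
    pair_prod g xs = pair_prod h xs"
proof (induction xs)
  case (Cons x xs)
  have "map (g x) xs = map (h x) xs" using Cons.prems by auto
  then show ?case using Cons by (auto simp del: map_eq_conv)
qed simp

lemma pair_prod_const: "(\<And>x y. x \<in> set xs \<Longrightarrow> y \<in> set xs \<Longrightarrow> g x y = 1) \<Longrightarrow> pair_prod g xs = 1"
proof (induction xs)
  case (Cons x xs)
  have "map (g x) xs = map (\<lambda>_. 1) xs" using Cons.prems by auto
  then show ?case using Cons by (simp add: map_replicate_const del: map_eq_conv)
qed simp

lemma pair_prod_star:
  assumes "distinct xs" "e \<in> set xs"
  shows "pair_prod (\<lambda>x y. if x = e then f y else if y = e then f x else 1) xs = prod f (set xs - {e})"
  using assms
proof (induction xs)
  case (Cons x xs)
  show ?case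
  proof (cases "x = e")
    case True
    have "pair_prod (\<lambda>x y. if x = e then f y else if y = e then f x else 1) xs = 1"
      using Cons.prems True by (intro pair_prod_const) auto
    then show ?thesis
      using Cons.prems True by (simp add: prod.distinct_set_conv_list)
  next
    case False
    have "prod_list (map (\<lambda>y. if y = e then f x else 1) xs) = prod (\<lambda>y. if y = e then f x else 1) (set xs)"
      using Cons.prems by (intro prod.distinct_set_conv_list[symmetric]) simp
    also have "\<dots> = f x"
      using Cons.prems False by simp
    finally have "pair_prod (\<lambda>x y. if x = e then f y else if y = e then f x else 1) (x # xs) =
        f x * prod f (set xs - {e})"
      using Cons False by simp
    also have "\<dots> = prod f (insert x (set xs - {e}))"
      using Cons.prems by simp
    also have "insert x (set xs - {e}) = set (x # xs) - {e}"
      using False by auto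
    finally show ?thesis .
  qed
qed simp

text \<open>For injective \<open>l\<close>, the product over all pairs of a list without repetitions
  is the sign of the permutation that sorts its \<open>B\<close>-entries by
  \<open>l\<close>.\<close>

definition inversion :: "('b \<Rightarrow> bool) \<Rightarrow> ('b \<Rightarrow> nat) \<Rightarrow> 'b \<Rightarrow> 'b \<Rightarrow> int" where
  "inversion B l x y = (if B x \<and> B y \<and> l y < l x then -1 else 1)"

text \<open>Each crossing of two \<open>B\<close>-strands reverses the order of exactly one pair.
  The numbering \<open>l\<close> is arbitrary, so it can be adapted to an orbit later.\<close>

lemma crossing_sign_pair_prod:
  assumes "braid_word (length xs) \<beta>" "distinct xs" "inj l"
  shows "crossing_sign \<beta> (map B xs) * pair_prod (inversion B l) xs =
    pair_prod (inversion B l) (permute_word \<beta> xs)"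
  using assms(1,2)
proof (induction \<beta> arbitrary: xs)
  case (Cons a \<beta>)
  define i where "i = artin_index a"
  have i: "1 \<le> i" "i < length xs" and \<beta>: "braid_word (length xs) \<beta>"
    using Cons.prems by (auto simp: i_def braid_word_Cons)
  let ?g = "inversion B l" and ?x = "xs ! (i - 1)" and ?y = "xs ! i"
  have "?x \<noteq> ?y" using Cons.prems i by (simp add: nth_eq_iff_index_eq)
  then have "l ?x \<noteq> l ?y" using assms(3) by (simp add: inj_eq)
  then have *: "?g ?x ?y * ?g ?y ?x = (if B ?x \<and> B ?y then -1 else 1)" "?g ?x ?y * ?g ?x ?y = 1"
    by (auto simp: inversion_def)
  have "pair_prod ?g (swap_at i xs) = ?g ?x ?y * (?g ?x ?y * pair_prod ?g (swap_at i xs))"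
    using *(2) by (metis mult.assoc mult_1)
  also have "\<dots> = (if B ?x \<and> B ?y then -1 else 1) * pair_prod ?g xs"
    unfolding pair_prod_swap_at[OF i] *(1)[symmetric] by (simp add: mult_ac)
  finally have swap: "pair_prod ?g (swap_at i xs) = \<dots>" .
  have "crossing_sign (a # \<beta>) (map B xs) * pair_prod ?g xs =
      crossing_sign \<beta> (map B (swap_at i xs)) * pair_prod ?g (swap_at i xs)"
    unfolding swap using i by (simp add: map_swap_at flip: i_def)
  also have "\<dots> = pair_prod ?g (permute_word \<beta> (swap_at i xs))"
  proof (rule Cons.IH)
    show "distinct (swap_at i xs)"
      using Cons.prems mset_swap_at[OF i] by (metis mset_eq_imp_distinct_iff)
  qed (use \<beta> in simp)
  finally show ?case by (simp flip: i_def)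
qed simp

lemma sum_colorings_trivial:
  assumes "1 \<le> n" "fixed_colorings n \<beta> \<subseteq> {replicate n False}" "braid_word n \<beta>"
  shows "(\<Sum>b\<in>fixed_colorings n \<beta>. color_weight b * crossing_sign \<beta> b) = 1"
proof -
  have swap: "swap_at i (replicate n False) = replicate n False" if "1 \<le> i" "i < n" for i
    using that by (intro swap_at_same) auto
  have "permute_word \<beta> (replicate n False) = replicate n False \<and> crossing_sign \<beta> (replicate n False) = 1"
    using assms(3) by (induction \<beta>) (auto simp: braid_word_Cons swap)
  moreover from this have "fixed_colorings n \<beta> = {replicate n False}"
    using assms(1,2) by (auto simp: fixed_colorings_def)
  ultimately show ?thesis
    by (simp add: color_weight_def)
qed

section \<open>The permutation of a braid word and its orbits\<close>

definition word_perm :: "nat \<Rightarrow> artin list \<Rightarrow> nat \<Rightarrow> nat" where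
  "word_perm n \<beta> k = (if k < n then permute_word \<beta> [0..<n] ! k else k)"

lemma permute_word_upt: "permute_word \<beta> [0..<n] = map (word_perm n \<beta>) [0..<n]"
  by (rule nth_equalityI) (auto simp: word_perm_def)

lemma permute_word_map:
  assumes "braid_word n \<beta>"
  shows "permute_word \<beta> (map f [0..<n]) = map (\<lambda>k. f (word_perm n \<beta> k)) [0..<n]"
proof -
  have "permute_word \<beta> (map f [0..<n]) = map f (permute_word \<beta> [0..<n])"
    using assms by (simp add: map_permute_word)
  then show ?thesis by (simp add: permute_word_upt)
qed

lemma word_perm_permutes:
  assumes "braid_word n \<beta>"
  shows "word_perm n \<beta> permutes {..<n}"
proof (rule bij_imp_permutes)
  have "mset (permute_word \<beta> [0..<n]) = mset [0..<n]"
    using assms by (intro mset_permute_word) simp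
  then have "distinct (permute_word \<beta> [0..<n])" "set (permute_word \<beta> [0..<n]) = {..<n}"
    using mset_eq_setD mset_eq_imp_distinct_iff by (fastforce, fastforce)
  then show "bij_betw (word_perm n \<beta>) {..<n} {..<n}"
    by (auto simp: permute_word_upt bij_betw_def distinct_map atLeast0LessThan)
qed (simp add: word_perm_def)

lemma square_one_cancel:
  fixes p :: "'a::comm_monoid_mult"
  assumes "p * p = 1" "x * p = y"
  shows "x = p * y"
proof -
  have "p * y = x * (p * p)" unfolding assms(2)[symmetric] by (simp only: mult_ac)
  then show ?thesis by (simp add: assms(1))
qed

lemma crossing_sign_eq:
  assumes \<beta>: "braid_word n \<beta>" and l: "inj l"
  defines "\<pi> \<equiv> word_perm n \<beta>"
  shows "crossing_sign \<beta> (map B [0..<n]) =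
    pair_prod (\<lambda>x y. inversion B l x y * inversion B l (\<pi> x) (\<pi> y)) [0..<n]"
proof -
  let ?g = "inversion B l"
  have "pair_prod ?g [0..<n] * pair_prod ?g [0..<n] = 1"
    unfolding pair_prod_mult by (rule pair_prod_const) (auto simp: inversion_def)
  moreover have "crossing_sign \<beta> (map B [0..<n]) * pair_prod ?g [0..<n] = pair_prod ?g (map \<pi> [0..<n])"
    using crossing_sign_pair_prod[of "[0..<n]" \<beta> l B] \<beta> l by (simp add: permute_word_upt \<pi>_def)
  ultimately have "crossing_sign \<beta> (map B [0..<n]) = pair_prod ?g [0..<n] * pair_prod ?g (map \<pi> [0..<n])"
    by (rule square_one_cancel)
  then show ?thesis
    by (simp only: pair_prod_map pair_prod_mult)
qed

text \<open>
  Number the strands of the orbit \<open>C\<close> of \<open>c\<close> cyclically, before all others. Then the only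
  pairs in \<open>B \<union> C\<close> but not in \<open>B\<close> whose order changes consist of the last strand of \<open>C\<close>
  and another strand of \<open>C\<close>.
\<close>

lemma crossing_sign_orbit:
  assumes \<beta>: "braid_word n \<beta>" and c: "c < n"
  defines "\<pi> \<equiv> word_perm n \<beta>"
  assumes B: "\<And>x. B (\<pi> x) = B x" and BC: "\<And>x. x \<in> range (\<lambda>m. (\<pi> ^^ m) c) \<Longrightarrow> \<not> B x"
  defines "C \<equiv> range (\<lambda>m. (\<pi> ^^ m) c)"
  shows "crossing_sign \<beta> (map (\<lambda>x. B x \<or> x \<in> C) [0..<n]) =
    (-1) ^ (card C - 1) * crossing_sign \<beta> (map B [0..<n])"
proof -
  have \<pi>: "\<pi> permutes {..<n}" unfolding \<pi>_def by (rule word_perm_permutes[OF \<beta>])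
  then have perm: "permutation \<pi>" by (auto simp: permutation_permutes)
  define N where "N = least_power \<pi> c"
  have N: "(\<pi> ^^ N) c = c" "0 < N"
    unfolding N_def using least_power_of_permutation[OF perm] by auto
  have CN: "C = (\<lambda>m. (\<pi> ^^ m) c) ` {..<N}"
    unfolding C_def using support_set[OF perm, of c] by (auto simp: N_def atLeast0LessThan)
  have inj: "inj_on (\<lambda>m. (\<pi> ^^ m) c) {..<N}"
    using cycle_of_permutation[OF perm, of c] by (simp add: N_def distinct_map atLeast0LessThan)
  have C_closed: "\<pi> x \<in> C \<longleftrightarrow> x \<in> C" for x
  proof
    assume "x \<in> C"
    then obtain m where "x = (\<pi> ^^ m) c" by (auto simp: C_def)
    then have "\<pi> x = (\<pi> ^^ Suc m) c" by simp
    then show "\<pi> x \<in> C" unfolding C_def by (rule range_eqI)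
  next
    assume "\<pi> x \<in> C"
    then obtain m where m: "\<pi> x = (\<pi> ^^ m) c" "m < N" by (auto simp: CN)
    have "\<pi> x = \<pi> ((\<pi> ^^ (m + N - 1)) c)"
    proof -
      have "Suc (m + N - 1) = m + N" using N by simp
      then have "\<pi> ((\<pi> ^^ (m + N - 1)) c) = (\<pi> ^^ (m + N)) c"
        by (metis comp_apply funpow.simps(2))
      then show ?thesis using m N by (simp add: funpow_add)
    qed
    then show "x \<in> C"
      using permutes_inj[OF \<pi>] by (auto simp: C_def inj_eq)
  qed
  have C_less: "x < n" if "x \<in> C" for x
  proof -
    obtain m where "x = (\<pi> ^^ m) c" using \<open>x \<in> C\<close> by (auto simp: C_def)
    moreover have "(\<pi> ^^ m) c \<in> {..<n}"
      using c by (induction m) (use permutes_in_image[OF \<pi>] in auto)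
    ultimately show ?thesis by simp
  qed
  define l where "l x = (if x \<in> C then the_inv_into {..<N} (\<lambda>m. (\<pi> ^^ m) c) x else N + x)" for x
  have l: "l ((\<pi> ^^ m) c) = m" if "m < N" for m
    using that the_inv_into_f_f[OF inj, of m] by (auto simp: l_def C_def)
  have C_cases: "\<exists>m<N. x = (\<pi> ^^ m) c \<and> l x = m" if "x \<in> C" for x
    using that l by (auto simp: CN)
  have l_less: "l x < N \<longleftrightarrow> x \<in> C" for x
    using C_cases[of x] by (auto simp: l_def)
  have l_inj: "inj l"
  proof (rule injI)
    fix x y assume eq: "l x = l y"
    then have "x \<in> C \<longleftrightarrow> y \<in> C" using l_less by metis
    then show "x = y"
      using eq C_cases[of x] C_cases[of y] by (cases "x \<in> C") (auto simp: l_def)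
  qed
  define e where "e = (\<pi> ^^ (N - 1)) c"
  have e: "e \<in> C" "l e = N - 1" using N l[of "N - 1"] by (auto simp: e_def C_def)
  have l_pi: "l (\<pi> x) = (if x = e then 0 else Suc (l x))" if x: "x \<in> C" for x
  proof -
    obtain m where m: "m < N" "x = (\<pi> ^^ m) c" "l x = m" using C_cases[OF x] by blast
    show ?thesis
    proof (cases "Suc m = N")
      case True
      then have "\<pi> x = (\<pi> ^^ N) c" using m by (auto simp flip: True)
      then show ?thesis using True m N l[of 0] by (auto simp: e_def)
    next
      case False
      have "\<pi> x = (\<pi> ^^ Suc m) c" using m by simp
      then have "l (\<pi> x) = Suc m" using l[of "Suc m"] False m by simp
      moreover have "x \<noteq> e" using e m False by auto
      ultimately show ?thesis using m by simp
    qed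
  qed
  let ?B' = "\<lambda>x. B x \<or> x \<in> C"
  let ?f = "\<lambda>x. if x \<in> C then -1 else 1 :: int"
  let ?g = "\<lambda>B x y. inversion B l x y * inversion B l (\<pi> x) (\<pi> y)"
  \<comment> \<open>Within \<open>C\<close>, \<pi> raises every label by one except the largest,
    that of \<open>e\<close>, which drops to 0; so a pair is reversed exactly if it contains
    \<open>e\<close>. Pairs with one member in \<open>C\<close> keep their order, and pairs outside
    \<open>C\<close> contribute the same sign for both colourings.\<close>
  have key: "?g ?B' x y * ?g B x y = (if x = e then ?f y else if y = e then ?f x else 1)"
    if "x \<noteq> y" for x y
  proof -
    have B_C: "\<not> B x" if "x \<in> C" for x using BC that by (simp add: C_def)
    consider "x \<in> C" "y \<in> C" | "x \<in> C" "y \<notin> C" | "x \<notin> C" "y \<in> C" | "x \<notin> C" "y \<notin> C"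
      by blast
    then show ?thesis
    proof cases
      case 1
      have "l x \<noteq> l y" using l_inj that by (simp add: inj_eq)
      moreover have "l x < N" "l y < N" using l_less 1 by auto
      ultimately show ?thesis
        using 1 that e B_C by (auto simp: inversion_def C_closed B l_pi)
    next
      case 2
      then have "l x < l y" "l (\<pi> x) < l (\<pi> y)"
        using l_less C_closed by (meson not_le less_le_trans)+
      then show ?thesis using 2 B_C e by (auto simp: inversion_def C_closed B)
    next
      case 3
      then have "l y < l x" "l (\<pi> y) < l (\<pi> x)"
        using l_less C_closed by (meson not_le less_le_trans)+
      then show ?thesis using 3 B_C e by (auto simp: inversion_def C_closed B)
    next
      case 4
      then show ?thesis using e by (auto simp: inversion_def C_closed B)
    qed
  qed
  have "crossing_sign \<beta> (map ?B' [0..<n]) * crossing_sign \<beta> (map B [0..<n]) =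
      pair_prod (\<lambda>x y. ?g ?B' x y * ?g B x y) [0..<n]"
    unfolding crossing_sign_eq[OF \<beta> l_inj, folded \<pi>_def] pair_prod_mult ..
  also have "\<dots> = pair_prod (\<lambda>x y. if x = e then ?f y else if y = e then ?f x else 1) [0..<n]"
    by (rule pair_prod_cong) (use key in auto)
  also have "\<dots> = prod ?f (set [0..<n] - {e})"
    using e C_less by (intro pair_prod_star) auto
  also have "\<dots> = prod ?f (C - {e})"
    by (rule prod.mono_neutral_right) (use C_less in auto)
  also have "\<dots> = (-1) ^ (card C - 1)"
    using e by simp
  finally have "crossing_sign \<beta> (map ?B' [0..<n]) * crossing_sign \<beta> (map B [0..<n]) = (-1) ^ (card C - 1)" .
  moreover have "crossing_sign \<beta> (map B [0..<n]) * crossing_sign \<beta> (map B [0..<n]) = 1"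
    unfolding crossing_sign_eq[OF \<beta> l_inj] pair_prod_mult
    by (rule pair_prod_const) (auto simp: inversion_def)
  ultimately show ?thesis
    by (subst mult.commute) (rule square_one_cancel)
qed

text \<open>Recolouring an orbit \<open>C\<close> that avoids the first strand multiplies the weight
  by (-1)^|C| and the crossing sign by (-1)^(|C|-1). This is an involution reversing the sign of
  every summand.\<close>

lemma sum_colorings_cancel:
  assumes \<beta>: "braid_word n \<beta>" and b: "b \<in> fixed_colorings n \<beta>" "b \<noteq> replicate n False"
  shows "(\<Sum>b\<in>fixed_colorings n \<beta>. color_weight b * crossing_sign \<beta> b) = 0"
proof -
  define \<pi> where "\<pi> = word_perm n \<beta>"
  have \<pi>: "\<pi> permutes {..<n}" unfolding \<pi>_def by (rule word_perm_permutes[OF \<beta>])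
  have fixed_iff: "map B [0..<n] \<in> fixed_colorings n \<beta> \<longleftrightarrow> \<not> B 0 \<and> (\<forall>x<n. B (\<pi> x) = B x)"
    if "0 < n" for B
    using that by (auto simp: fixed_colorings_def permute_word_map[OF \<beta>] \<pi>_def)
  obtain c where c: "c < n" "b ! c"
    using b by (auto simp: fixed_colorings_def list_eq_iff_nth_eq)
  define C where "C = range (\<lambda>m. (\<pi> ^^ m) c)"
  have n: "0 < n" using c by simp
  have C_less: "x < n" if "x \<in> C" for x
  proof -
    obtain m where "x = (\<pi> ^^ m) c" using \<open>x \<in> C\<close> by (auto simp: C_def)
    moreover have "(\<pi> ^^ m) c \<in> {..<n}"
      using c by (induction m) (use permutes_in_image[OF \<pi>] in auto)
    ultimately show ?thesis by simp
  qed
  have const: "B x = B c" if "\<And>x. x < n \<Longrightarrow> B (\<pi> x) = B x" "x \<in> C" for B :: "nat \<Rightarrow> bool" and x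
  proof -
    have "B ((\<pi> ^^ m) c) = B c \<and> (\<pi> ^^ m) c < n" for m
      using c that(1) permutes_in_image[OF \<pi>] by (induction m) auto
    then show ?thesis using \<open>x \<in> C\<close> by (auto simp: C_def)
  qed
  have b_fix: "b ! (\<pi> x) = b ! x" if "x < n" for x
    using b fixed_iff[OF n, of "\<lambda>x. b ! x"] that by (auto simp: fixed_colorings_def map_nth)
  have C0: "0 \<notin> C"
    using const[of "\<lambda>x. b ! x" 0] b_fix c b by (auto simp: fixed_colorings_def)
  have cC: "c \<in> C" unfolding C_def by (rule range_eqI[of _ _ 0]) simp
  define toggle where "toggle b = map (\<lambda>x. b ! x \<noteq> (x \<in> C)) [0..<n]" for b
  have C_closed: "\<pi> x \<in> C \<longleftrightarrow> x \<in> C" if "x < n" for x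
  proof
    assume "x \<in> C"
    then obtain m where "x = (\<pi> ^^ m) c" by (auto simp: C_def)
    then have "\<pi> x = (\<pi> ^^ Suc m) c" by simp
    then show "\<pi> x \<in> C" unfolding C_def by (rule range_eqI)
  next
    have fin: "finite C" using C_less by (meson finite_nat_set_iff_bounded)
    have "\<pi> ` C \<subseteq> C"
    proof safe
      fix x assume "x \<in> C"
      then obtain m where "x = (\<pi> ^^ m) c" by (auto simp: C_def)
      then have "\<pi> x = (\<pi> ^^ Suc m) c" by simp
      then show "\<pi> x \<in> C" unfolding C_def by (rule range_eqI)
    qed
    then have "\<pi> ` C = C"
      using fin permutes_inj_on[OF \<pi>] by (intro endo_inj_surj) auto
    moreover assume "\<pi> x \<in> C"
    ultimately show "x \<in> C"
      using permutes_inj[OF \<pi>] by (metis imageE injD)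
  qed
  have toggle_fixed: "toggle d \<in> fixed_colorings n \<beta>" if "d \<in> fixed_colorings n \<beta>" for d
  proof -
    have "d = map (\<lambda>x. d ! x) [0..<n]" using that by (auto simp: fixed_colorings_def map_nth)
    then have "\<not> d ! 0 \<and> (\<forall>x<n. d ! \<pi> x = d ! x)" using fixed_iff[OF n] that by metis
    then show ?thesis
      unfolding toggle_def fixed_iff[OF n] using C0 C_closed by auto
  qed
  have toggle_toggle: "toggle (toggle d) = d" if "d \<in> fixed_colorings n \<beta>" for d
    using that by (auto simp: toggle_def list_eq_iff_nth_eq fixed_colorings_def)
  have union: "color_weight (map (\<lambda>x. B x \<or> x \<in> C) [0..<n]) * crossing_sign \<beta> (map (\<lambda>x. B x \<or> x \<in> C) [0..<n]) =
      - (color_weight (map B [0..<n]) * crossing_sign \<beta> (map B [0..<n]))"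
    if B: "\<And>x. x < n \<Longrightarrow> B (\<pi> x) = B x" "\<not> B c" for B
  proof -
    \<comment> \<open>Extended by False beyond \<open>n\<close>, where \<pi> is the identity, the
      colouring is invariant on all natural numbers, as \<open>crossing_sign_orbit\<close>
      demands.\<close>
    define B' where "B' x = (x < n \<and> B x)" for x
    have B': "B' (\<pi> x) = B' x" for x
      using B(1)[of x] permutes_in_image[OF \<pi>, of x] permutes_not_in[OF \<pi>, of x] by (auto simp: B'_def)
    have BC: "\<not> B' x" if "x \<in> C" for x
      using const[of B x] B that by (simp add: B'_def)
    have eq: "map B [0..<n] = map B' [0..<n]"
      "map (\<lambda>x. B x \<or> x \<in> C) [0..<n] = map (\<lambda>x. B' x \<or> x \<in> C) [0..<n]"
      by (auto simp: B'_def)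
    have sign: "crossing_sign \<beta> (map (\<lambda>x. B' x \<or> x \<in> C) [0..<n]) =
        (-1) ^ (card C - 1) * crossing_sign \<beta> (map B' [0..<n])"
      unfolding C_def \<pi>_def
      by (rule crossing_sign_orbit[OF \<beta> c(1)]) (use B' BC in \<open>auto simp: C_def \<pi>_def\<close>)
    have weight: "color_weight (map D [0..<n]) = (\<Prod>x<n. if D x then -1 else 1)" for D
      by (simp add: color_weight_def prod.distinct_set_conv_list[symmetric] atLeast0LessThan o_def)
    have "color_weight (map (\<lambda>x. B' x \<or> x \<in> C) [0..<n]) =
        (\<Prod>x<n. (if B' x then -1 else 1) * (if x \<in> C then -1 else 1))"
      unfolding weight by (rule prod.cong) (use BC in auto)
    also have "\<dots> = color_weight (map B' [0..<n]) * (\<Prod>x<n. if x \<in> C then -1 else 1)"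
      unfolding weight by (rule prod.distrib)
    also have "(\<Prod>x<n. if x \<in> C then -1 else 1 :: int) = (\<Prod>x\<in>C. -1)"
      by (rule prod.mono_neutral_cong_right) (use C_less in auto)
    finally have "color_weight (map (\<lambda>x. B' x \<or> x \<in> C) [0..<n]) =
        color_weight (map B' [0..<n]) * (-1) ^ card C" by simp
    moreover have "card C = Suc (card C - 1)"
    proof -
      have "finite C" using C_less by (meson finite_nat_set_iff_bounded)
      then have "0 < card C" using cC by (auto simp: card_gt_0_iff)
      then show ?thesis by simp
    qed
    then obtain m where m: "card C = Suc m" by blast
    then have "W * (-1) ^ card C * ((-1) ^ (card C - 1) * S) = - (W * S)" for W S :: int
      by (simp flip: mult.assoc power_mult_distrib)
    ultimately show ?thesis
      unfolding eq sign by simp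
  qed
  let ?t = "\<lambda>b. color_weight b * crossing_sign \<beta> b"
  have neg: "?t (toggle d) = - ?t d" if d: "d \<in> fixed_colorings n \<beta>" for d
  proof -
    have d_map: "map ((!) d) [0..<n] = d" using d by (auto simp: fixed_colorings_def map_nth)
    then have d_fix: "d ! \<pi> x = d ! x" if "x < n" for x
      using fixed_iff[OF n, of "(!) d"] d that unfolding d_map by blast
    show ?thesis
    proof (cases "d ! c")
      case False
      then have "\<not> d ! x" if "x \<in> C" for x using const[of "\<lambda>x. d ! x" x] d_fix that by simp
      then have "toggle d = map (\<lambda>x. d ! x \<or> x \<in> C) [0..<n]" by (auto simp: toggle_def)
      then show ?thesis using union[of "\<lambda>x. d ! x"] d_fix False d_map by simp
    next
      case True
      then have dC: "d ! x" if "x \<in> C" for x using const[of "\<lambda>x. d ! x" x] d_fix that by simp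
      let ?B = "\<lambda>x. d ! x \<and> x \<notin> C"
      have "toggle d = map ?B [0..<n]" using dC by (auto simp: toggle_def)
      moreover have "map (\<lambda>x. ?B x \<or> x \<in> C) [0..<n] = d"
        using dC d by (auto simp: list_eq_iff_nth_eq fixed_colorings_def)
      ultimately show ?thesis
        using union[of ?B] d_fix C_closed cC by simp
    qed
  qed
  have "(\<Sum>b\<in>fixed_colorings n \<beta>. ?t b) = (\<Sum>b\<in>fixed_colorings n \<beta>. ?t (toggle b))"
    by (rule sum.reindex_bij_witness[where i = toggle and j = toggle])
      (simp_all add: toggle_fixed toggle_toggle)
  also have "\<dots> = - (\<Sum>b\<in>fixed_colorings n \<beta>. ?t b)"
    by (simp add: neg sum_negf)
  finally show ?thesis by simp
qed

section \<open>Components of the closure\<close>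

definition end_pos :: "artin list \<Rightarrow> nat \<Rightarrow> nat \<Rightarrow> nat" where
  "end_pos \<beta> k j = (if k < length \<beta> then Transposition.transpose (artin_index (rev \<beta> ! k)) (Suc (artin_index (rev \<beta> ! k))) j else j)"

lemma crossing_strand_0: "crossing_strand a j 0 = (real j, 0)"
  by (cases a) auto

lemma crossing_strand_1: "crossing_strand a j 1 = (real (Transposition.transpose (artin_index a) (Suc (artin_index a)) j), 0)"
  by (cases a) (auto simp: Transposition.transpose_def)

lemma sector_strand_0: "sector_strand \<beta> k j 0 = (real j, 0)"
  by (simp add: sector_strand_def crossing_strand_0)

lemma sector_strand_1: "sector_strand \<beta> k j 1 = (real (end_pos \<beta> k j), 0)"
  by (simp add: sector_strand_def crossing_strand_1 end_pos_def)

text \<open>The two crossing strands share their position only at \<tau> = 1/2, where their heights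
  are 1/4 and 0.\<close>

lemma crossing_strand_inj:
  assumes "0 \<le> \<tau>" "\<tau> \<le> 1" "crossing_strand a j \<tau> = crossing_strand a j' \<tau>"
  shows "j = j'"
proof -
  have half: "\<tau> * (1 - \<tau>) \<noteq> 0" if "real i + \<tau> = real (i + 1) - \<tau>" for i
    using that by auto
  have nat: "j = i" if "real j = real i + \<tau>" "j \<noteq> i + 1" for i j
    using that assms(1,2) by linarith
  have nat': "j = i + 1" if "real j = real (i + 1) - \<tau>" "j \<noteq> i" for i j
    using that assms(1,2) by linarith
  show ?thesis
    using assms(3) half nat nat' by (cases a) (auto split: if_splits; metis)+
qed

lemma sector_strand_inj:
  assumes "0 \<le> \<tau>" "\<tau> \<le> 1" "sector_strand \<beta> k j \<tau> = sector_strand \<beta> k j' \<tau>"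
  shows "j = j'"
  using assms crossing_strand_inj[OF assms(1,2)] by (auto simp: sector_strand_def split: if_splits)

lemma braid_word_rev_nth:
  "braid_word n \<beta> \<Longrightarrow> k < length \<beta> \<Longrightarrow> 1 \<le> artin_index (rev \<beta> ! k) \<and> artin_index (rev \<beta> ! k) < n"
  using nth_mem[of k "rev \<beta>"] by (simp add: braid_word_def)

lemma sector_strand_pos:
  assumes "braid_word n \<beta>" "0 \<le> \<tau>" "\<tau> \<le> 1" "1 \<le> j"
  shows "0 < fst (sector_strand \<beta> k j \<tau>)"
proof (cases "k < length \<beta>")
  case True
  then show ?thesis
    using assms braid_word_rev_nth[OF assms(1) True] by (cases "rev \<beta> ! k") (auto simp: sector_strand_def)
qed (use assms in \<open>simp add: sector_strand_def\<close>)

lemma continuous_on_crossing_strand: "continuous_on S (crossing_strand a j)"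
proof (cases a)
  case (Gen i)
  have "continuous_on S (\<lambda>\<tau>. crossing_strand (Gen i) j \<tau>)"
    unfolding crossing_strand.simps
    by (cases "j = i"; cases "j = i + 1") (auto intro!: continuous_intros)
  then show ?thesis by (simp only: Gen)
next
  case (GenInv i)
  have "continuous_on S (\<lambda>\<tau>. crossing_strand (GenInv i) j \<tau>)"
    unfolding crossing_strand.simps
    by (cases "j = i"; cases "j = i + 1") (auto intro!: continuous_intros)
  then show ?thesis by (simp only: GenInv)
qed

lemma continuous_on_closure_arc: "continuous_on S (closure_arc \<beta> k j)"
proof -
  have "continuous_on S (sector_strand \<beta> k j)"
    by (cases "k < length \<beta>")
      (auto simp: sector_strand_def[abs_def] intro!: continuous_on_crossing_strand continuous_intros)
  moreover have "closure_arc \<beta> k j = (\<lambda>\<tau>. (of_real (fst (sector_strand \<beta> k j \<tau>)) *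
      cis (2 * pi * (real k + \<tau>) / real (length \<beta> + 1)), snd (sector_strand \<beta> k j \<tau>)))"
    by (auto simp: closure_arc_def fun_eq_iff split: prod.split)
  ultimately show ?thesis
    by (auto intro!: continuous_intros)
qed

definition strand_arc :: "artin list \<Rightarrow> nat \<Rightarrow> nat \<Rightarrow> (complex \<times> real) set" where
  "strand_arc \<beta> k j = closure_arc \<beta> k j ` {0..1}"

lemma connected_strand_arc: "connected (strand_arc \<beta> k j)"
  unfolding strand_arc_def by (intro connected_continuous_image continuous_on_closure_arc) simp

lemma compact_strand_arc: "compact (strand_arc \<beta> k j)"
  unfolding strand_arc_def by (intro compact_continuous_image continuous_on_closure_arc) simp

lemma closure_arc_in_strand_arc: "0 \<le> \<tau> \<Longrightarrow> \<tau> \<le> 1 \<Longrightarrow> closure_arc \<beta> k j \<tau> \<in> strand_arc \<beta> k j"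
  by (simp add: strand_arc_def)

lemma braid_closure_eq: "braid_closure n \<beta> = (\<Union>k\<in>{0..length \<beta>}. \<Union>j\<in>{1..n}. strand_arc \<beta> k j)"
  by (simp add: braid_closure_def strand_arc_def)

lemma closure_arc_1:
  assumes "k < length \<beta>"
  shows "closure_arc \<beta> k j 1 = closure_arc \<beta> (Suc k) (end_pos \<beta> k j) 0"
  by (simp add: closure_arc_def sector_strand_0 sector_strand_1 add.commute)

lemma closure_arc_last: "closure_arc \<beta> (length \<beta>) j 1 = closure_arc \<beta> 0 j 0"
proof -
  have "2 * pi * (real (length \<beta>) + 1) / real (length \<beta> + 1) = 2 * pi"
    by (simp add: field_simps)
  then show ?thesis
    by (simp only: closure_arc_def sector_strand_0 sector_strand_1) (simp add: end_pos_def)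
qed

lemma cis_eq_cis:
  assumes "cis x = cis y" "0 \<le> x" "x \<le> 2 * pi" "0 \<le> y" "y \<le> 2 * pi"
  shows "x = y \<or> x = 0 \<and> y = 2 * pi \<or> x = 2 * pi \<and> y = 0"
proof -
  have "cis (x - y) = 1"
    using assms(1) by (simp add: cis_divide[symmetric])
  then have "cos (x - y) = 1" by (simp add: complex_eq_iff)
  then obtain m :: int where m: "x - y = real_of_int m * (2 * pi)"
    using cos_one_2pi_int by (metis mult.commute mult.assoc)
  have "\<bar>x - y\<bar> \<le> 2 * pi"
    using assms by linarith
  then have "\<bar>real_of_int m\<bar> \<le> 1"
    by (simp add: m abs_mult)
  then have "m = 0 \<or> m = 1 \<or> m = -1" by linarith
  then show ?thesis using m assms by auto
qed

text \<open>Distances from the axis are positive, so a point determines position and angle. Equal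
  angles mean the same moment of the same sector or the seam between two consecutive sectors, the
  last and the first included; inside a sector distinct strands do not meet.\<close>

lemma closure_arc_eq_cases:
  assumes \<beta>: "braid_word n \<beta>"
    and eq: "closure_arc \<beta> k j \<tau> = closure_arc \<beta> k' j' \<tau>'"
    and \<tau>: "0 \<le> \<tau>" "\<tau> \<le> 1" "0 \<le> \<tau>'" "\<tau>' \<le> 1"
    and k: "k \<le> length \<beta>" "k' \<le> length \<beta>" and j: "1 \<le> j" "1 \<le> j'"
  shows "k = k' \<and> j = j' \<or> Suc k = k' \<and> j' = end_pos \<beta> k j \<or> Suc k' = k \<and> j = end_pos \<beta> k' j' \<or>
    j = j' \<and> {k, k'} = {0, length \<beta>}"
proof -
  define N where "N = real (length \<beta> + 1)"
  have N: "0 < N" by (simp add: N_def)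
  let ?r = "fst (sector_strand \<beta> k j \<tau>)" and ?r' = "fst (sector_strand \<beta> k' j' \<tau>')"
  let ?x = "2 * pi * (real k + \<tau>) / N" and ?y = "2 * pi * (real k' + \<tau>') / N"
  have r: "0 < ?r" "0 < ?r'" using sector_strand_pos[OF \<beta>] \<tau> j by auto
  have c: "of_real ?r * cis ?x = of_real ?r' * cis ?y" and
    z: "snd (sector_strand \<beta> k j \<tau>) = snd (sector_strand \<beta> k' j' \<tau>')"
    using eq by (simp_all only: closure_arc_def N_def case_prod_unfold Let_def prod.inject)
  have "norm (of_real ?r * cis ?x) = norm (of_real ?r' * cis ?y)" by (simp only: c)
  then have r_eq: "?r = ?r'" using r by (simp add: norm_mult)
  then have strand: "sector_strand \<beta> k j \<tau> = sector_strand \<beta> k' j' \<tau>'"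
    using z by (simp add: prod_eq_iff)
  have cis: "cis ?x = cis ?y" using c r r_eq by auto
  have bound: "0 \<le> 2 * pi * (real k + \<tau>) / N \<and> 2 * pi * (real k + \<tau>) / N \<le> 2 * pi"
    if "k \<le> length \<beta>" "0 \<le> \<tau>" "\<tau> \<le> 1" for k \<tau>
    using that by (auto simp: N_def divide_le_eq intro!: mult_left_mono)
  consider "?x = ?y" | "?x = 0" "?y = 2 * pi" | "?x = 2 * pi" "?y = 0"
    using cis_eq_cis[OF cis] bound[OF k(1) \<tau>(1,2)] bound[OF k(2) \<tau>(3,4)] by blast
  then show ?thesis
  proof cases
    case 1
    then have sum: "real k + \<tau> = real k' + \<tau>'" using N by simp
    then consider "k = k'" "\<tau> = \<tau>'" | "Suc k = k'" "\<tau> = 1" "\<tau>' = 0" | "Suc k' = k" "\<tau> = 0" "\<tau>' = 1"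
      using \<tau> by (cases k k' rule: linorder_cases) (force, force, force)
    then show ?thesis
      using strand sector_strand_inj[OF \<tau>(1,2)]
      by cases (auto simp: sector_strand_0 sector_strand_1)
  next
    case 2
    then have "real k + \<tau> = 0" "real k' + \<tau>' = N" using N by (auto simp: divide_eq_eq)
    then have "k = 0" "\<tau> = 0" "k' = length \<beta>" "\<tau>' = 1" using \<tau> k by (auto simp: N_def)
    then show ?thesis using strand by (auto simp: sector_strand_0 sector_strand_1 end_pos_def)
  next
    case 3
    then have "real k' + \<tau>' = 0" "real k + \<tau> = N" using N by (auto simp: divide_eq_eq)
    then have "k' = 0" "\<tau>' = 0" "k = length \<beta>" "\<tau> = 1" using \<tau> k by (auto simp: N_def)
    then show ?thesis using strand by (auto simp: sector_strand_0 sector_strand_1 end_pos_def)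
  qed
qed

lemma permute_word_append: "permute_word (\<beta> @ \<gamma>) x = permute_word \<gamma> (permute_word \<beta> x)"
  by (induction \<beta> arbitrary: x) auto

lemma swap_at_swap_at: "1 \<le> i \<Longrightarrow> i < length x \<Longrightarrow> swap_at i (swap_at i x) = x"
  by (auto simp: swap_at_def list_eq_iff_nth_eq nth_list_update)

lemma permute_word_rev:
  "braid_word (length x) \<beta> \<Longrightarrow> permute_word (rev \<beta>) (permute_word \<beta> x) = x"
  by (induction \<beta> arbitrary: x) (auto simp: braid_word_Cons permute_word_append swap_at_swap_at)

text \<open>The sectors of the closure follow the reversed word, the trace the word itself. Reversal
  inverts the permutation, which leaves the fixed colourings the same.\<close>

lemma permute_word_rev_fixed_iff:
  assumes "braid_word (length x) \<beta>"
  shows "permute_word (rev \<beta>) x = x \<longleftrightarrow> permute_word \<beta> x = x"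
  using permute_word_rev[OF assms] permute_word_rev[of x "rev \<beta>"] assms
  by (auto simp: braid_word_def)

lemma permute_word_replicate:
  assumes "braid_word n \<beta>"
  shows "permute_word \<beta> (replicate n c) = replicate n c"
  using map_permute_word[of "replicate n c" \<beta> "\<lambda>_. c"] assms by (simp add: map_replicate_const)

lemma permute_word_take_Suc:
  "k < length \<beta> \<Longrightarrow> permute_word (take (Suc k) (rev \<beta>)) x =
    swap_at (artin_index (rev \<beta> ! k)) (permute_word (take k (rev \<beta>)) x)"
  by (simp add: take_Suc_conv_app_nth permute_word_append)

lemma swap_at_nth_end_pos:
  assumes "braid_word n \<beta>" "k < length \<beta>" "length x = n" "1 \<le> j" "j \<le> n"
  shows "swap_at (artin_index (rev \<beta> ! k)) x ! (j - 1) = x ! (end_pos \<beta> k j - 1)"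
  using braid_word_rev_nth[OF assms(1,2)] assms
  by (auto simp: swap_at_def end_pos_def Transposition.transpose_def nth_list_update)

lemma end_pos_bounds:
  assumes "braid_word n \<beta>" "1 \<le> j" "j \<le> n"
  shows "1 \<le> end_pos \<beta> k j" "end_pos \<beta> k j \<le> n"
  using braid_word_rev_nth[OF assms(1), of k] assms by (auto simp: end_pos_def Transposition.transpose_def)

lemma end_pos_end_pos [simp]: "end_pos \<beta> k (end_pos \<beta> k j) = j"
  by (simp add: end_pos_def)

lemma strand_arc_subset: "k \<le> length \<beta> \<Longrightarrow> 1 \<le> j \<Longrightarrow> j \<le> n \<Longrightarrow> strand_arc \<beta> k j \<subseteq> braid_closure n \<beta>"
  by (force simp: braid_closure_eq)

text \<open>The colouring, transported through the sectors, sorts the arcs by colour. Arcs of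
  different colours never meet, so the two finite unions of compact arcs separate the
  closure.\<close>

lemma not_connected_braid_closure:
  assumes \<beta>: "braid_word n \<beta>" and b: "b \<in> fixed_colorings n \<beta>" "b \<noteq> replicate n False"
  shows "\<not> connected (braid_closure n \<beta>)"
proof -
  define c where "c k = permute_word (take k (rev \<beta>)) b" for k
  have len: "length b = n" "length (c k) = n" for k
    using b by (auto simp: c_def fixed_colorings_def)
  have c0: "c 0 = b" by (simp add: c_def)
  have c_last: "c (length \<beta>) = b"
    using b \<beta> permute_word_rev_fixed_iff[of b \<beta>] by (simp add: c_def fixed_colorings_def)
  have c_Suc: "c (Suc k) ! (end_pos \<beta> k j - 1) = c k ! (j - 1)"
    if "k < length \<beta>" "1 \<le> j" "j \<le> n" for k j
    using that swap_at_nth_end_pos[OF \<beta> that(1) len(2)[of k], of "end_pos \<beta> k j"]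
      end_pos_bounds[OF \<beta> that(2,3), of k] by (simp add: c_def permute_word_take_Suc)
  define A where "A v = (\<Union>k\<in>{0..length \<beta>}. \<Union>j\<in>{j\<in>{1..n}. c k ! (j - 1) = v}. strand_arc \<beta> k j)" for v
  have closed: "closed (A v)" for v
    unfolding A_def by (intro closed_UN ballI compact_imp_closed compact_strand_arc) auto
  have cover: "braid_closure n \<beta> = A True \<union> A False"
    unfolding A_def braid_closure_eq by blast
  have disjoint: "A True \<inter> A False = {}"
  proof (rule ccontr)
    assume "A True \<inter> A False \<noteq> {}"
    then obtain p where p: "p \<in> A True" "p \<in> A False" by blast
    obtain k j \<tau> where 1: "p = closure_arc \<beta> k j \<tau>" "0 \<le> \<tau>" "\<tau> \<le> 1" "k \<le> length \<beta>" "1 \<le> j" "j \<le> n"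
      "c k ! (j - 1)"
      using p(1) by (auto simp: A_def strand_arc_def)
    obtain k' j' \<tau>' where 2: "p = closure_arc \<beta> k' j' \<tau>'" "0 \<le> \<tau>'" "\<tau>' \<le> 1" "k' \<le> length \<beta>" "1 \<le> j'"
      "j' \<le> n" "\<not> c k' ! (j' - 1)"
      using p(2) by (auto simp: A_def strand_arc_def)
    have "closure_arc \<beta> k j \<tau> = closure_arc \<beta> k' j' \<tau>'" using 1 2 by simp
    from closure_arc_eq_cases[OF \<beta> this 1(2,3) 2(2,3) 1(4) 2(4) 1(5) 2(5)] show False
      using 1(4-) 2(4-) c_Suc[of k j] c_Suc[of k' j'] c0 c_last by (auto simp: doubleton_eq_iff)
  qed
  obtain j where j: "j < n" "b ! j"
    using b len by (auto simp: list_eq_iff_nth_eq)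
  have "closure_arc \<beta> 0 (Suc j) 0 \<in> A True"
    using j c0 by (auto simp: A_def intro!: bexI[of _ 0] exI[of _ "Suc j"] closure_arc_in_strand_arc)
  moreover have "closure_arc \<beta> 0 1 0 \<in> A False"
    using j b c0 by (auto simp: A_def fixed_colorings_def intro!: bexI[of _ 0] exI[of _ "Suc 0"] closure_arc_in_strand_arc)
  ultimately have "A True \<inter> braid_closure n \<beta> \<noteq> {}" "A False \<inter> braid_closure n \<beta> \<noteq> {}"
    "A True \<inter> A False \<inter> braid_closure n \<beta> = {}" "braid_closure n \<beta> \<subseteq> A True \<union> A False"
    unfolding cover using disjoint by auto
  with closed[of True] closed[of False] show ?thesis
    unfolding connected_closed by metis
qed

text \<open>Conversely, each arc lies on one side of a separation, and consecutive arcs on the same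
  side. The sides thus form a colouring fixed by the braid, which has to be constant.\<close>

lemma connected_braid_closure:
  assumes \<beta>: "braid_word n \<beta>" and n: "1 \<le> n" and triv: "fixed_colorings n \<beta> \<subseteq> {replicate n False}"
  shows "connected (braid_closure n \<beta>)"
  unfolding connected_closed
proof (intro notI, elim exE conjE)
  fix A B assume AB: "closed A" "closed B" "braid_closure n \<beta> \<subseteq> A \<union> B" "A \<inter> B \<inter> braid_closure n \<beta> = {}"
    "A \<inter> braid_closure n \<beta> \<noteq> {}" "B \<inter> braid_closure n \<beta> \<noteq> {}"
  have arc_cases: "strand_arc \<beta> k j \<subseteq> A \<and> strand_arc \<beta> k j \<inter> B = {} \<or>
      strand_arc \<beta> k j \<subseteq> B \<and> strand_arc \<beta> k j \<inter> A = {}" if "k \<le> length \<beta>" "1 \<le> j" "j \<le> n" for k j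
    using connected_closedD[OF connected_strand_arc[of \<beta> k j], of A B] AB strand_arc_subset[OF that] by blast
  define c where "c k = map (\<lambda>j. strand_arc \<beta> k (Suc j) \<subseteq> A) [0..<n]" for k
  have c: "c k ! (j - 1) \<longleftrightarrow> closure_arc \<beta> k j \<tau> \<in> A"
    if "k \<le> length \<beta>" "1 \<le> j" "j \<le> n" "0 \<le> \<tau>" "\<tau> \<le> 1" for k j \<tau>
    using arc_cases[OF that(1,2,3)] closure_arc_in_strand_arc[OF that(4,5), of \<beta> k j] that by (auto simp: c_def)
  have "c (Suc k) = swap_at (artin_index (rev \<beta> ! k)) (c k)" if k: "k < length \<beta>" for k
  proof (rule nth_equalityI)
    fix l assume "l < length (c (Suc k))"
    then have l: "1 \<le> Suc l" "Suc l \<le> n" by (auto simp: c_def)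
    note e = end_pos_bounds[OF \<beta> l, of k]
    have "c (Suc k) ! (Suc l - 1) \<longleftrightarrow> c k ! (end_pos \<beta> k (Suc l) - 1)"
      using c[of "Suc k" "Suc l" 0] c[of k "end_pos \<beta> k (Suc l)" 1] closure_arc_1[OF k, of "end_pos \<beta> k (Suc l)"]
        k l e by simp
    then show "c (Suc k) ! l = swap_at (artin_index (rev \<beta> ! k)) (c k) ! l"
      using swap_at_nth_end_pos[OF \<beta> k, of "c k" "Suc l"] l by (simp add: c_def)
  qed (simp add: c_def)
  then have c_eq: "c k = permute_word (take k (rev \<beta>)) (c 0)" if "k \<le> length \<beta>" for k
    using that by (induction k) (auto simp: permute_word_take_Suc)
  have "c (length \<beta>) = c 0"
  proof (rule nth_equalityI)
    fix l assume "l < length (c (length \<beta>))"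
    then show "c (length \<beta>) ! l = c 0 ! l"
      using c[of "length \<beta>" "Suc l" 1] c[of 0 "Suc l" 0] closure_arc_last[of \<beta> "Suc l"] by (simp add: c_def)
  qed (simp add: c_def)
  then have "permute_word (rev \<beta>) (c 0) = c 0"
    using c_eq[of "length \<beta>"] by simp
  moreover have "length (c 0) = n" by (simp add: c_def)
  ultimately have fixed: "permute_word \<beta> (c 0) = c 0"
    using permute_word_rev_fixed_iff[of "c 0" \<beta>] \<beta> by simp
  have "\<exists>v. c 0 = replicate n v"
  proof (cases "c 0 ! 0")
    case False
    then have "c 0 \<in> fixed_colorings n \<beta>" using fixed by (simp add: fixed_colorings_def c_def)
    then show ?thesis using triv by blast
  next
    \<comment> \<open>Exchanging the two colours makes the first strand uncoloured.\<close>
    case True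
    have "map Not (c 0) \<in> fixed_colorings n \<beta>"
      using True fixed n \<beta> map_permute_word[of "c 0" \<beta> Not] by (simp add: fixed_colorings_def c_def)
    then have "map Not (c 0) = replicate n False" using triv by blast
    then have "map Not (map Not (c 0)) = replicate n True" by simp
    then show ?thesis by (auto simp: o_def)
  qed
  then obtain v where v: "c 0 = replicate n v" by blast
  have "c k = replicate n v" if "k \<le> length \<beta>" for k
    unfolding c_eq[OF that] v using \<beta> by (intro permute_word_replicate) (auto simp: braid_word_def dest: in_set_takeD)
  then have "c k ! (j - 1) = v" if "k \<le> length \<beta>" "1 \<le> j" "j \<le> n" for k j
    using that by simp
  then have "x \<in> A \<longleftrightarrow> v" if "x \<in> braid_closure n \<beta>" for x
    using that c by (fastforce simp: braid_closure_eq strand_arc_def)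
  then show False using AB by blast
qed

lemma is_knot_braid_closure_iff:
  assumes "braid_word n \<beta>" "1 \<le> n"
  shows "is_knot (braid_closure n \<beta>) \<longleftrightarrow> fixed_colorings n \<beta> \<subseteq> {replicate n False}"
proof -
  have "closure_arc \<beta> 0 1 0 \<in> braid_closure n \<beta>"
    using assms strand_arc_subset[of 0 \<beta> 1 n] closure_arc_in_strand_arc[of 0 \<beta> 0 1] by auto
  then have "is_knot (braid_closure n \<beta>) \<longleftrightarrow> connected (braid_closure n \<beta>)"
    using components_eq_sing_exists[of "braid_closure n \<beta>"] by (auto simp: is_knot_def card_1_singleton_iff)
  then show ?thesis
    using connected_braid_closure[OF assms] not_connected_braid_closure[OF assms(1)] by blast
qed

lemma laurent_eval_ADO3_eq:
  assumes "braid_word n \<beta>" "2 \<le> n" "z = 1 \<or> z = omega"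
  shows "laurent_eval (ADO3 n \<beta>) z = (if is_knot (braid_closure n \<beta>) then 1 else 0)"
proof -
  have d: "ado_d omega 1 = ado_k omega 1"
    by (simp add: ado_d_def ado_k_def fun_eq_iff)
  have n: "1 \<le> n" using assms by simp
  have "laurent_eval (ADO3 n \<beta>) z = graded_trace n \<beta>"
    using assms laurent_eval_ADO3_one laurent_eval_ADO3_omega by blast
  also have "\<dots> = of_int (\<Sum>b\<in>fixed_colorings n \<beta>. color_weight b * crossing_sign \<beta> b)"
    unfolding graded_trace_def d sum_graded_R_eq_super_flip[OF omega_square assms(2,1)]
    by (rule sum_super_flip_eq_sum_colorings[OF omega_square assms(1) n])
  also have "(\<Sum>b\<in>fixed_colorings n \<beta>. color_weight b * crossing_sign \<beta> b) =
      (if is_knot (braid_closure n \<beta>) then 1 else 0)"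
    unfolding is_knot_braid_closure_iff[OF assms(1) n]
    using sum_colorings_trivial[OF n _ assms(1)] sum_colorings_cancel[OF assms(1)] by auto
  finally show ?thesis by simp
qed

theorem corollary1p2:
  fixes \<beta> :: "artin list" and L :: "(complex \<times> real) set"
  assumes "braid_word 5 \<beta>" and "L = braid_closure 5 \<beta>"
  shows "laurent_eval (ADO3 5 \<beta>) 1 = laurent_eval (ADO3 5 \<beta>) omega \<and>
    laurent_eval (ADO3 5 \<beta>) omega = (if is_knot L then 1 else 0)"
  using laurent_eval_ADO3_eq[OF assms(1)] assms(2) by simp

end
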